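(* Let $A=(a_{ij})\in H_n$ with $a_{ii}\neq 0$ for all $i\in\{1,\dots,n\}$. Then $\rho(H_{BGS})<1$ (i.e., the sequence $\{x^{(i)}\}$ generated by the BGS scheme converges to the unique solution of $Ax=b$ for any choice of the initial guess $x^{(0)}$) if and only if both of the following hold: (i) $A$ has no $2\times 2$ irreducible principal submatrix belonging to $GDE_2$; (ii) $A$ has no irreducible principal submatrix $A_k=A(i_1,i_2,\dots,i_k)$, $3\le k\le n$, such that $D_{A_k}^{-1}A_k\in \mathscr{L}^{\phi}_k\cap GDE_k$ for some $\phi\in\mathbb{R}$, where $D_{A_k}=\mathrm{diag}(a_{i_1i_1},\dots,a_{i_ki_k})$.
   Context: The comparison matrix $\mu(A)=(\mu_{ij})$ of $A\in\mathbb{C}^{n\times n}$ has $\mu_{ii}=|a_{ii}|$ and $\mu_{ij}=-|a_{ij}|$ for $i\ne j$. A real matrix with nonpositive off-diagonal entries is an $M$-matrix if it equals $sI-B$ with $B\ge 0$ entrywise and $s\ge\rho(B)$ (singular $M$-matrices are allowed). $H_n$ (general $H$-matrices) is the set of $A\in\mathbb{C}^{n\times n}$ such that $\mu(A)$ is an $M$-matrix. $GDE_k$ is the set of generalized diagonally equipotent $k\times k$ complex matrices: there are positive constants $\alpha_1,\dots,\alpha_k$ with $\alpha_i|a_{ii}|=\sum_{j\ne i}\alpha_j|a_{ij}|$ for all $i$. $A(i_1,\dots,i_k)$, $i_1<\dots<i_k$, is the principal submatrix of $A$ with rows and columns $i_1,\dots,i_k$. Write $A=D_A-L_A-U_A$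 with $D_A=\mathrm{diag}(a_{11},\dots,a_{nn})$, $L_A$ strictly lower triangular, $U_A$ strictly upper triangular. The backward Gauss-Seidel (BGS) iteration matrix is $H_{BGS}=(D_A-U_A)^{-1}L_A$, and the BGS scheme for $Ax=b$ is $x^{(i+1)}=H_{BGS}x^{(i)}+(D_A-U_A)^{-1}b$, $i=0,1,2,\dots$. $\rho$ denotes the spectral radius. A matrix $(e^{i\phi_{rs}})\in\mathbb{C}^{k\times k}$ ($\phi_{rs}\in\mathbb{R}$, $i=\sqrt{-1}$) is a $\phi$-ray pattern matrix ($\phi\in\mathbb{R}$) if, modulo $2\pi$: (1) $\phi_{rs}+\phi_{sr}\equiv\phi$ for all $r\ne s$; (2) $\phi_{rs}-\phi_{rt}\equiv\phi_{ts}-\phi+\pi$ whenever $r<s<t$ or $s<t<r$ or $t<r<s$; (3) $\phi_{rs}-\phi_{rt}\equiv\phi_{ts}+\pi$ whenever $r<t<s$ or $t<s<r$ or $s<r<t$; (4) $\phi_{rr}=0$ for all $r$. $\mathscr{L}^{\phi}_k$ is the set of $k\times k$ complex matrices $B=(b_{rs})$ for which there exist $\eta\in\mathbb{R}$ and a $\phi$-ray pattern matrix $(e^{i\phi_{rs}})$ with $b_{rs}=e^{i\eta}|b_{rs}|e^{i\phi_{rs}}$ for all $r,s$. *)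

theory Defs
  imports
    "Jordan_Normal_Form.Spectral_Radius"
    "Jordan_Normal_Form.Gauss_Jordan_Elimination"
    "Jordan_Normal_Form.DL_Submatrix"
    "HOL-Library.Real_Mod"
begin

text \<open>Rows and columns are numbered from \<open>0\<close>.\<close>

text \<open>Only meaningful for invertible square matrices, where \<^const>\<open>mat_inverse\<close> is not
  \<^const>\<open>None\<close>.\<close>

definition mat_inv :: "complex mat \<Rightarrow> complex mat" where
  "mat_inv A = the (mat_inverse A)"

definition comparison_mat :: "complex mat \<Rightarrow> real mat" where
  "comparison_mat A = mat (dim_row A) (dim_col A)
     (\<lambda>(i, j). if i = j then cmod (A $$ (i, j)) else - cmod (A $$ (i, j)))"

text \<open>The spectral radius is that of \<open>B\<close> viewed as a complex matrix; it is a \<^const>\<open>Max\<close> over a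
  nonempty set only for \<open>n > 0\<close>.  Singular M-matrices are included.\<close>

definition M_matrix :: "nat \<Rightarrow> real mat \<Rightarrow> bool" where
  "M_matrix n M \<longleftrightarrow> M \<in> carrier_mat n n \<and>
     (\<forall>i<n. \<forall>j<n. i \<noteq> j \<longrightarrow> M $$ (i, j) \<le> 0) \<and>
     (\<exists>s. \<exists>B\<in>carrier_mat n n. (\<forall>i<n. \<forall>j<n. 0 \<le> B $$ (i, j)) \<and>
        spectral_radius (map_mat complex_of_real B) \<le> s \<and>
        M = s \<cdot>\<^sub>m 1\<^sub>m n - B)"

definition H_matrices :: "nat \<Rightarrow> complex mat set" where
  "H_matrices n = {A \<in> carrier_mat n n. M_matrix n (comparison_mat A)}"

definition GDE :: "nat \<Rightarrow> complex mat set" where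
  "GDE k = {A \<in> carrier_mat k k. \<exists>\<alpha> :: nat \<Rightarrow> real. (\<forall>i<k. 0 < \<alpha> i) \<and>
     (\<forall>i<k. \<alpha> i * cmod (A $$ (i, i)) = (\<Sum>j\<in>{..<k} - {i}. \<alpha> j * cmod (A $$ (i, j))))}"

text \<open>Reducible: a simultaneous permutation of rows and columns produces a block upper triangular
  matrix with square diagonal blocks of sizes \<open>r\<close> and \<open>n - r\<close>, \<open>1 \<le> r < n\<close>.\<close>

definition reducible_mat :: "nat \<Rightarrow> complex mat \<Rightarrow> bool" where
  "reducible_mat n A \<longleftrightarrow> (\<exists>p r. p permutes {..<n} \<and> 1 \<le> r \<and> r < n \<and>
     (\<forall>i j. r \<le> i \<and> i < n \<and> j < r \<longrightarrow> A $$ (p i, p j) = 0))"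

definition irreducible_mat :: "nat \<Rightarrow> complex mat \<Rightarrow> bool" where
  "irreducible_mat n A \<longleftrightarrow> \<not> reducible_mat n A"

abbreviation principal_submatrix :: "complex mat \<Rightarrow> nat set \<Rightarrow> complex mat" where
  "principal_submatrix A I \<equiv> submatrix A I I"

definition diag_part :: "complex mat \<Rightarrow> complex mat" where
  "diag_part A = mat_diag (dim_row A) (\<lambda>i. A $$ (i, i))"

text \<open>The triangular parts carry a minus sign, so that \<open>A = D\<^sub>A - L\<^sub>A - U\<^sub>A\<close>.\<close>

definition lower_part :: "complex mat \<Rightarrow> complex mat" where
  "lower_part A = mat (dim_row A) (dim_col A) (\<lambda>(i, j). if j < i then - A $$ (i, j) else 0)"

definition upper_part :: "complex mat \<Rightarrow> complex mat" where
  "upper_part A = mat (dim_row A) (dim_col A) (\<lambda>(i, j). if i < j then - A $$ (i, j) else 0)"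

definition BGS_mat :: "complex mat \<Rightarrow> complex mat" where
  "BGS_mat A = mat_inv (diag_part A - upper_part A) * lower_part A"

primrec BGS_seq :: "complex mat \<Rightarrow> complex vec \<Rightarrow> complex vec \<Rightarrow> nat \<Rightarrow> complex vec" where
  "BGS_seq A b x0 0 = x0"
| "BGS_seq A b x0 (Suc m) =
     BGS_mat A *\<^sub>v BGS_seq A b x0 m + mat_inv (diag_part A - upper_part A) *\<^sub>v b"

definition BGS_convergent :: "nat \<Rightarrow> complex mat \<Rightarrow> complex vec \<Rightarrow> bool" where
  "BGS_convergent n A b \<longleftrightarrow>
     (\<exists>x\<in>carrier_vec n. A *\<^sub>v x = b \<and> (\<forall>y\<in>carrier_vec n. A *\<^sub>v y = b \<longrightarrow> y = x) \<and>
        (\<forall>x0\<in>carrier_vec n. \<forall>j<n. (\<lambda>m. BGS_seq A b x0 m $ j) \<longlonglongrightarrow> x $ j))"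

definition ray_pattern :: "nat \<Rightarrow> real \<Rightarrow> complex mat \<Rightarrow> bool" where
  "ray_pattern k \<phi> R \<longleftrightarrow> (\<exists>f :: nat \<Rightarrow> nat \<Rightarrow> real.
     R = mat k k (\<lambda>(r, s). cis (f r s)) \<and>
     (\<forall>r<k. \<forall>s<k. r \<noteq> s \<longrightarrow> [f r s + f s r = \<phi>] (rmod 2 * pi)) \<and>
     (\<forall>r<k. \<forall>s<k. \<forall>t<k. (r < s \<and> s < t) \<or> (s < t \<and> t < r) \<or> (t < r \<and> r < s) \<longrightarrow>
        [f r s - f r t = f t s - \<phi> + pi] (rmod 2 * pi)) \<and>
     (\<forall>r<k. \<forall>s<k. \<forall>t<k. (r < t \<and> t < s) \<or> (t < s \<and> s < r) \<or> (s < r \<and> r < t) \<longrightarrow>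
        [f r s - f r t = f t s + pi] (rmod 2 * pi)) \<and>
     (\<forall>r<k. f r r = 0))"

definition L_class :: "nat \<Rightarrow> real \<Rightarrow> complex mat set" where
  "L_class k \<phi> = {B \<in> carrier_mat k k. \<exists>\<eta> R. ray_pattern k \<phi> R \<and>
     (\<forall>r<k. \<forall>s<k. B $$ (r, s) = cis \<eta> * complex_of_real (cmod (B $$ (r, s))) * R $$ (r, s))}"

end

theory Submission
  imports Defs
begin

text \<open>
  A number \<open>z\<close> is an eigenvalue of the iteration matrix iff \<open>z (D - U) - L\<close> is singular.  If \<open>\<bar>z\<bar> \<ge> 1\<close>,
  restrict this matrix to a minimal index set \<open>S\<close> on which it is singular; there it is irreducible, and
  the triangle inequality applied to a null vector \<open>x\<close> gives \<open>\<mu>(A) \<bar>x\<bar> \<le> 0\<close> on \<open>S\<close>.  An M-matrix admits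
  no nonnegative \<open>u\<close> with \<open>\<mu>(A) u < 0\<close> on a nonempty index set: in \<open>\<mu>(A) = s I - B\<close> the matrix \<open>B\<close> would have spectral radius
  larger than \<open>s\<close>; by irreducibility a single strict inequality could be spread over all of
  \<open>S\<close>.  Hence \<open>\<mu>(A) \<bar>x\<bar> = 0\<close> with \<open>\<bar>x\<bar> > 0\<close> on \<open>S\<close>, which forces \<open>\<bar>z\<bar> = 1\<close>, and equality in the
  triangle inequality fixes the phases of the entries of \<open>A\<close> on \<open>S\<close>: up to a diagonal unitary
  similarity they are those of the ray patterns, with \<open>z = e\<^sup>i\<^sup>\<phi>\<close>.
  Conversely such a set \<open>S\<close> carries a null vector, and it is a maximal irreducible set, since on a
  larger one the null vector extended by zero would have to be positive.  Block triangularity then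
  makes the whole matrix singular for some \<open>z\<close> of modulus \<open>1\<close>.
\<close>


section \<open>Irreducible index sets and nonnegative weights\<close>

text \<open>Encoded on index sets, so that passing to subsets needs no renumbering, and through the
  zero pattern off the diagonal, so that one notion serves both the complex pencil and the moduli of
  \<open>A\<close>. The empty set and singletons qualify vacuously.\<close>

definition irred_on :: "(nat \<Rightarrow> nat \<Rightarrow> 'a::zero) \<Rightarrow> nat set \<Rightarrow> bool" where
  "irred_on a S \<longleftrightarrow> (\<forall>Q. Q \<noteq> {} \<and> Q \<subset> S \<longrightarrow> (\<exists>i\<in>S - Q. \<exists>j\<in>Q. a i j \<noteq> 0))"

lemma irred_onD:
  assumes "irred_on a S" "Q \<noteq> {}" "Q \<subset> S"
  obtains i j where "i \<in> S - Q" "j \<in> Q" "a i j \<noteq> 0"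
proof -
  have "\<exists>i\<in>S - Q. \<exists>j\<in>Q. a i j \<noteq> 0" using assms by (simp add: irred_on_def)
  then show thesis by (elim bexE) (rule that)
qed

lemma irred_on_cong:
  assumes "\<And>i j. i \<in> S \<Longrightarrow> j \<in> S \<Longrightarrow> i \<noteq> j \<Longrightarrow> a i j = 0 \<longleftrightarrow> b i j = 0"
  shows "irred_on a S \<longleftrightarrow> irred_on b S"
proof -
  have "(\<exists>i\<in>S - Q. \<exists>j\<in>Q. a i j \<noteq> 0) \<longleftrightarrow> (\<exists>i\<in>S - Q. \<exists>j\<in>Q. b i j \<noteq> 0)" if "Q \<subset> S" for Q
  proof -
    have "a i j = 0 \<longleftrightarrow> b i j = 0" if "i \<in> S - Q" "j \<in> Q" for i j
      using assms that \<open>Q \<subset> S\<close> by blast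
    then show ?thesis by (intro bex_cong refl) simp
  qed
  then show ?thesis unfolding irred_on_def by (intro all_cong1 imp_cong refl) simp
qed

text \<open>For \<open>w i j\<close> = |a_ij| this is minus the \<open>i\<close>-th entry of
  \<mu>(A) u, with \<mu>(A) restricted to \<open>S\<close>.\<close>

definition excess :: "(nat \<Rightarrow> nat \<Rightarrow> real) \<Rightarrow> nat set \<Rightarrow> (nat \<Rightarrow> real) \<Rightarrow> nat \<Rightarrow> real" where
  "excess w S u i = (\<Sum>j\<in>S - {i}. w i j * u j) - w i i * u i"

lemma excess_upd:
  assumes "finite S" "j \<in> S"
  shows "excess w S (u(j := u j + \<delta>)) l = excess w S u l + (if l = j then - w j j * \<delta> else w l j * \<delta>)"
proof (cases "l = j")
  case True
  have "(\<Sum>k\<in>S - {j}. w j k * (u(j := u j + \<delta>)) k) = (\<Sum>k\<in>S - {j}. w j k * u k)"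
    by (intro sum.cong) auto
  with True show ?thesis by (simp add: excess_def algebra_simps)
next
  case False
  with assms have f: "finite (S - {l})" "j \<in> S - {l}" by auto
  have "(\<Sum>k\<in>S - {l} - {j}. w l k * (u(j := u j + \<delta>)) k) = (\<Sum>k\<in>S - {l} - {j}. w l k * u k)"
    by (intro sum.cong) auto
  then have "(\<Sum>k\<in>S - {l}. w l k * (u(j := u j + \<delta>)) k) = (\<Sum>k\<in>S - {l}. w l k * u k) + w l j * \<delta>"
    by (simp add: sum.remove[OF f] algebra_simps)
  with False show ?thesis by (simp add: excess_def)
qed

text \<open>Induction on the number of rows without strict excess. Raising the weight of a strict
  row \<open>j\<close> lowers no excess but that of row \<open>j\<close> itself. Irreducibility
  supplies a non-strict row \<open>i\<close> with \<open>w i j > 0\<close>, which becomes strict,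
  while a small enough raise keeps row \<open>j\<close> strict.\<close>

lemma strict_excess_spreads:
  assumes "finite S" "irred_on w S" "\<And>i j. i \<in> S \<Longrightarrow> j \<in> S \<Longrightarrow> 0 \<le> w i j"
    and "\<And>i. i \<in> S \<Longrightarrow> 0 \<le> u i" "\<And>i. i \<in> S \<Longrightarrow> 0 \<le> excess w S u i"
    and "\<exists>i\<in>S. 0 < excess w S u i"
  shows "\<exists>v. (\<forall>i\<in>S. 0 \<le> v i) \<and> (\<forall>i\<in>S. 0 < excess w S v i)"
  using assms(4-6)
proof (induction "card {i\<in>S. excess w S u i \<le> 0}" arbitrary: u rule: less_induct)
  case less
  show ?case
  proof (cases "\<forall>i\<in>S. 0 < excess w S u i")
    case True
    with less.prems(1) show ?thesis by blast
  next
    case False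
    define Q where "Q = {i\<in>S. 0 < excess w S u i}"
    have "Q \<noteq> {}" "Q \<subset> S" using False less.prems(3) by (auto simp: Q_def)
    then obtain i j where ij: "i \<in> S - Q" "j \<in> Q" "w i j \<noteq> 0"
      using irred_onD[OF assms(2)] by blast
    then have S: "i \<in> S" "j \<in> S" "i \<noteq> j" and wij: "0 < w i j"
      using assms(3)[of i j] by (auto simp: Q_def)
    have ej: "0 < excess w S u j" using ij by (simp add: Q_def)
    have wjj: "0 \<le> w j j" using assms(3) S by blast
    \<comment> \<open>The raise costs row \<open>j\<close> the amount
      \<open>w j j * \<delta>\<close>, less than half of its excess; the summand 1 keeps the
      denominator positive when \<open>w j j = 0\<close>.\<close>
    define \<delta> where "\<delta> = excess w S u j / (2 * (1 + w j j))"
    have \<delta>: "0 < \<delta>" using ej wjj by (simp add: \<delta>_def)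
    have "w j j * \<delta> < (2 * (1 + w j j)) * \<delta>"
      using \<delta> wjj by (intro mult_strict_right_mono) auto
    also have "\<dots> = excess w S u j" using wjj by (simp add: \<delta>_def)
    finally have \<delta>j: "w j j * \<delta> < excess w S u j" .
    define v where "v = u(j := u j + \<delta>)"
    have ex: "excess w S v l = excess w S u l + (if l = j then - w j j * \<delta> else w l j * \<delta>)" for l
      unfolding v_def by (rule excess_upd[OF assms(1) S(2)])
    have le: "excess w S v l \<ge> excess w S u l" if "l \<in> S" "l \<noteq> j" for l
      using that \<delta> assms(3)[of l j] S by (simp add: ex)
    have vj: "0 < excess w S v j" using \<delta>j by (simp add: ex)
    have vi: "0 < excess w S v i"
      using wij \<delta> S less.prems(2)[of i] by (simp add: ex add_nonneg_pos)
    have "{l\<in>S. excess w S v l \<le> 0} \<subset> {l\<in>S. excess w S u l \<le> 0}"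
    proof
      show "{l\<in>S. excess w S v l \<le> 0} \<subseteq> {l\<in>S. excess w S u l \<le> 0}"
        using le vj by force
      have "i \<in> {l\<in>S. excess w S u l \<le> 0}" using ij by (auto simp: Q_def)
      moreover have "i \<notin> {l\<in>S. excess w S v l \<le> 0}" using vi by auto
      ultimately show "{l\<in>S. excess w S v l \<le> 0} \<noteq> {l\<in>S. excess w S u l \<le> 0}"
        by blast
    qed
    then have "card {l\<in>S. excess w S v l \<le> 0} < card {l\<in>S. excess w S u l \<le> 0}"
      using assms(1) by (intro psubset_card_mono) auto
    moreover have "0 \<le> v l" if "l \<in> S" for l
      using less.prems(1)[OF that] \<delta> by (auto simp: v_def)
    moreover have "0 \<le> excess w S v l" if "l \<in> S" for l
      using le[OF that] vj less.prems(2)[OF that] by (cases "l = j") auto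
    moreover have "\<exists>l\<in>S. 0 < excess w S v l" using vj S by blast
    ultimately show ?thesis by (rule less.hyps)
  qed
qed

text \<open>A Perron-Frobenius argument. One strict row would spread to all of \<open>S\<close>,
  against \<open>no_strict\<close>, so every row is tight. If \<open>u i = 0\<close> in a tight row,
  then \<open>u j = 0\<close> wherever \<open>w i j\<close> is nonzero off the diagonal;
  irreducibility excludes this at the boundary of the support of \<open>u\<close>.\<close>

lemma irreducible_nonneg_excess:
  assumes "finite S" "irred_on w S" "\<And>i j. i \<in> S \<Longrightarrow> j \<in> S \<Longrightarrow> 0 \<le> w i j"
    and no_strict: "\<And>v. (\<And>i. i \<in> S \<Longrightarrow> 0 \<le> v i) \<Longrightarrow> (\<And>i. i \<in> S \<Longrightarrow> 0 < excess w S v i) \<Longrightarrow> False"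
    and u: "\<And>i. i \<in> S \<Longrightarrow> 0 \<le> u i" "\<And>i. i \<in> S \<Longrightarrow> 0 \<le> excess w S u i"
    and nz: "\<exists>i\<in>S. u i \<noteq> 0" and i: "i \<in> S"
  shows "excess w S u i = 0" "0 < u i"
proof -
  have zero: "excess w S u i = 0" if "i \<in> S" for i
  proof (rule ccontr)
    assume "excess w S u i \<noteq> 0"
    then have "\<exists>i\<in>S. 0 < excess w S u i" using u(2)[OF that] that by force
    from strict_excess_spreads[OF assms(1-3) u this] no_strict show False by blast
  qed
  show "excess w S u i = 0" using zero[OF i] .
  define Q where "Q = {i\<in>S. 0 < u i}"
  have "Q = S"
  proof (rule ccontr)
    assume "Q \<noteq> S"
    moreover have "Q \<noteq> {}" using nz u(1) by (force simp: Q_def)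
    ultimately obtain i j where ij: "i \<in> S - Q" "j \<in> Q" "w i j \<noteq> 0"
      using irred_onD[OF assms(2), of Q] by (auto simp: Q_def)
    then have S: "i \<in> S" "j \<in> S" "i \<noteq> j" "0 < u j" by (auto simp: Q_def)
    have "u i = 0" using ij u(1)[of i] by (auto simp: Q_def)
    then have "(\<Sum>k\<in>S - {i}. w i k * u k) = 0" using zero[OF S(1)] by (simp add: excess_def)
    then have "\<forall>k\<in>S - {i}. w i k * u k = 0"
      using assms(1,3) u(1) S(1) by (subst (asm) sum_nonneg_eq_0_iff) auto
    then show False using S ij(3) by auto
  qed
  then show "0 < u i" using i by (auto simp: Q_def)
qed

section \<open>Singularity on index sets\<close>

definition singular_on :: "(nat \<Rightarrow> nat \<Rightarrow> 'a::field) \<Rightarrow> nat set \<Rightarrow> bool" where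
  "singular_on a S \<longleftrightarrow> (\<exists>x. (\<exists>i\<in>S. x i \<noteq> 0) \<and> (\<forall>i\<in>S. (\<Sum>j\<in>S. a i j * x j) = 0))"

text \<open>Padding the block on \<open>S\<close> with an identity block gives a square matrix with
  trivial kernel, so its determinant is nonzero and an inverse solves the system; \<open>S\<close>
  keeps its numbering.\<close>

lemma nonsingular_on_solvable:
  assumes "finite S" "\<not> singular_on a S"
  shows "\<exists>x. \<forall>i\<in>S. (\<Sum>j\<in>S. a i j * x j) = b i"
proof -
  obtain n where n: "S \<subseteq> {..<n}" using finite_nat_iff_bounded assms(1) by blast
  define M where "M = mat n n (\<lambda>(i, j). if i \<in> S \<and> j \<in> S then a i j else if i = j then 1 else 0)"
  have M: "M \<in> carrier_mat n n" by (simp add: M_def)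
  have row: "(\<Sum>j<n. M $$ (i, j) * x j) = (\<Sum>j\<in>S. a i j * x j)" if "i \<in> S" for i x
  proof -
    have "(\<Sum>j\<in>S. a i j * x j) = (\<Sum>j<n. if j \<in> S then a i j * x j else 0)"
      using n by (simp add: sum.inter_restrict[symmetric] Int_absorb1)
    also have "\<dots> = (\<Sum>j<n. M $$ (i, j) * x j)"
      using that n by (intro sum.cong) (auto simp: M_def)
    finally show ?thesis by simp
  qed
  have mv: "(M *\<^sub>v v) $ i = (\<Sum>j<n. M $$ (i, j) * v $ j)" if "i < n" "v \<in> carrier_vec n" for i v
    using that M by (auto simp: scalar_prod_def atLeast0LessThan intro!: sum.cong)
  have "det M \<noteq> 0"
  proof
    assume "det M = 0"
    then obtain v where v: "v \<in> carrier_vec n" "v \<noteq> 0\<^sub>v n" "M *\<^sub>v v = 0\<^sub>v n"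
      using det_0_iff_vec_prod_zero[OF M] by blast
    have s: "(\<Sum>j<n. M $$ (i, j) * v $ j) = 0" if "i < n" for i
      using mv[OF that v(1)] v(3) that by simp
    have "v $ i = 0" if "i < n" for i
    proof (cases "i \<in> S")
      case True
      have "\<forall>i\<in>S. (\<Sum>j\<in>S. a i j * v $ j) = 0" using s row n by (metis lessThan_iff subsetD)
      then show ?thesis using assms(2) True unfolding singular_on_def by blast
    next
      case False
      have "(\<Sum>j<n. M $$ (i, j) * v $ j) = (\<Sum>j<n. if j = i then v $ i else 0)"
        using that False by (intro sum.cong) (auto simp: M_def)
      then show ?thesis using s[OF that] that by simp
    qed
    then have "v = 0\<^sub>v n" using v(1) by (intro eq_vecI) auto
    with v(2) show False ..
  qed
  from det_non_zero_imp_unit[OF M this, of "()"]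
  obtain N where N: "N \<in> carrier_mat n n" "M * N = 1\<^sub>m n"
    by (auto simp: Units_def ring_mat_def)
  define v where "v = N *\<^sub>v vec n b"
  have v: "v \<in> carrier_vec n" using N by (simp add: v_def)
  have "M *\<^sub>v v = (M * N) *\<^sub>v vec n b" unfolding v_def
    by (rule assoc_mult_mat_vec[symmetric, OF M N(1)]) simp
  then have "M *\<^sub>v v = vec n b" using N(2) by simp
  then have "(\<Sum>j\<in>S. a i j * v $ j) = b i" if "i \<in> S" for i
    using mv[of i v] v row[OF that] n that by (auto simp: subset_iff)
  then show ?thesis by blast
qed

section \<open>Block triangular splittings of an index set\<close>

context
  fixes a :: "nat \<Rightarrow> nat \<Rightarrow> 'a::field" and S Q :: "nat set"
  assumes fin: "finite S" and sub: "Q \<subseteq> S"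
    and block: "\<And>i j. i \<in> S - Q \<Longrightarrow> j \<in> Q \<Longrightarrow> a i j = 0"
begin

lemma block_sum_split:
  "(\<Sum>j\<in>S. a i j * x j) = (\<Sum>j\<in>Q. a i j * x j) + (\<Sum>j\<in>S - Q. a i j * x j)"
  using sum.subset_diff[OF sub fin, of "\<lambda>j. a i j * x j"] by (simp add: add.commute)

lemma block_sum_lower:
  assumes "i \<in> S - Q" shows "(\<Sum>j\<in>S. a i j * x j) = (\<Sum>j\<in>S - Q. a i j * x j)"
  using assms by (simp add: block_sum_split block)

text \<open>A null vector on \<open>Q\<close>, extended by zero, is also annihilated by the rows
  outside \<open>Q\<close>, because these vanish on the columns in \<open>Q\<close>.\<close>

lemma singular_on_leading_block:
  assumes "singular_on a Q" shows "singular_on a S"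
proof -
  from assms obtain x where x: "\<exists>i\<in>Q. x i \<noteq> 0" "\<forall>i\<in>Q. (\<Sum>j\<in>Q. a i j * x j) = 0"
    unfolding singular_on_def by blast
  define y where "y j = (if j \<in> Q then x j else 0)" for j
  have "(\<Sum>j\<in>S. a i j * y j) = (\<Sum>j\<in>Q. a i j * x j)" for i
    using sub by (simp add: block_sum_split y_def)
  then have "(\<Sum>j\<in>S. a i j * y j) = 0" if "i \<in> S" for i
    using x(2) block[of i] that by (cases "i \<in> Q") auto
  moreover have "\<exists>i\<in>S. y i \<noteq> 0" using x(1) sub by (force simp: y_def)
  ultimately show ?thesis unfolding singular_on_def by blast
qed

text \<open>If the block on \<open>Q\<close> is nonsingular, a null vector on \<open>S - Q\<close>
  is completed by solving the rows in \<open>Q\<close> for the missing entries. If it is singular,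
  the leading block already suffices.\<close>

lemma singular_on_trailing_block:
  assumes "singular_on a (S - Q)" shows "singular_on a S"
proof (cases "singular_on a Q")
  case False
  from assms obtain x where x: "\<exists>i\<in>S - Q. x i \<noteq> 0" "\<forall>i\<in>S - Q. (\<Sum>j\<in>S - Q. a i j * x j) = 0"
    unfolding singular_on_def by blast
  from nonsingular_on_solvable[OF finite_subset[OF sub fin] False, of "\<lambda>i. - (\<Sum>j\<in>S - Q. a i j * x j)"]
  obtain z where z: "\<And>i. i \<in> Q \<Longrightarrow> (\<Sum>j\<in>Q. a i j * z j) = - (\<Sum>j\<in>S - Q. a i j * x j)"
    by blast
  define y where "y j = (if j \<in> Q then z j else x j)" for j
  have "(\<Sum>j\<in>S. a i j * y j) = (\<Sum>j\<in>Q. a i j * z j) + (\<Sum>j\<in>S - Q. a i j * x j)" for i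
    by (simp add: block_sum_split y_def)
  then have "(\<Sum>j\<in>S. a i j * y j) = 0" if "i \<in> S" for i
    using x(2) z block[of i] that by (cases "i \<in> Q") auto
  moreover have "\<exists>i\<in>S. y i \<noteq> 0" using x(1) by (force simp: y_def)
  ultimately show ?thesis unfolding singular_on_def by blast
qed (rule singular_on_leading_block)

text \<open>A null vector that is nonzero somewhere off \<open>Q\<close> restricts to a null vector
  on \<open>S - Q\<close>; otherwise it is supported in \<open>Q\<close> and is a null vector
  there.\<close>

lemma singular_on_block_cases:
  assumes "singular_on a S" shows "singular_on a Q \<or> singular_on a (S - Q)"
proof -
  from assms obtain x where x: "\<exists>i\<in>S. x i \<noteq> 0" "\<forall>i\<in>S. (\<Sum>j\<in>S. a i j * x j) = 0"
    unfolding singular_on_def by blast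
  show ?thesis
  proof (cases "\<exists>i\<in>S - Q. x i \<noteq> 0")
    case True
    have "\<forall>i\<in>S - Q. (\<Sum>j\<in>S - Q. a i j * x j) = 0"
      using x(2) block_sum_lower by force
    with True show ?thesis unfolding singular_on_def by blast
  next
    case False
    then have "\<forall>i\<in>Q. (\<Sum>j\<in>Q. a i j * x j) = 0"
      using x(2) sub by (force simp: block_sum_split)
    moreover have "\<exists>i\<in>Q. x i \<noteq> 0" using x(1) False by blast
    ultimately show ?thesis unfolding singular_on_def by blast
  qed
qed

end

lemma not_irred_onD:
  assumes "\<not> irred_on a S"
  obtains Q where "Q \<noteq> {}" "Q \<subset> S" "\<And>i j. i \<in> S - Q \<Longrightarrow> j \<in> Q \<Longrightarrow> a i j = 0"
proof -
  obtain Q where "(Q \<noteq> {} \<and> Q \<subset> S) \<and> \<not> (\<exists>i\<in>S - Q. \<exists>j\<in>Q. a i j \<noteq> 0)"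
    using assms unfolding irred_on_def not_all not_imp by (rule exE)
  then show thesis by (intro that[of Q]) auto
qed

text \<open>Induction on the cardinality: a reducible set splits into two proper diagonal blocks,
  and one of them is again singular.\<close>

lemma singular_on_irreducible_subset:
  assumes "finite S" "singular_on a S"
  obtains T where "T \<subseteq> S" "singular_on a T" "irred_on a T"
  using assms
proof (induction "card S" arbitrary: S thesis rule: less_induct)
  case less
  show ?case
  proof (cases "irred_on a S")
    case False
    then obtain Q where Q: "Q \<noteq> {}" "Q \<subset> S" "\<And>i j. i \<in> S - Q \<Longrightarrow> j \<in> Q \<Longrightarrow> a i j = 0"
      by (rule not_irred_onD) blast
    from singular_on_block_cases[of S Q a] less.prems Q
    have sing: "singular_on a Q \<or> singular_on a (S - Q)" by blast
    have sub: "Q \<subset> S" "S - Q \<subset> S" using Q by auto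
    then have "\<exists>R. R \<subset> S \<and> singular_on a R" using sing by blast
    then obtain R where R: "R \<subset> S" "singular_on a R" by blast
    show ?thesis
    proof (rule less.hyps[of R])
      show "card R < card S" using R less.prems(2) by (simp add: psubset_card_mono)
      show "finite R" using R less.prems(2) by (meson finite_subset psubset_imp_subset)
      show "singular_on a R" by fact
    qed (use R less.prems(1) in blast)
  qed (use less.prems in blast)
qed

text \<open>As long as \<open>S\<close> is larger than \<open>I\<close> it is reducible, and
  \<open>I\<close> lies inside one of its two diagonal blocks. Maximality of \<open>I\<close> is
  inherited by that block, so induction makes the block singular, and a singular diagonal block
  makes a block triangular matrix singular.\<close>

lemma singular_on_maximal_irreducible:
  assumes "finite S" "singular_on a I" "irred_on a I" "I \<subseteq> S"
    and "\<And>T. I \<subset> T \<Longrightarrow> T \<subseteq> S \<Longrightarrow> \<not> irred_on a T"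
  shows "singular_on a S"
  using assms(1,4,5)
proof (induction "card S" arbitrary: S rule: less_induct)
  case less
  show ?case
  proof (cases "I = S")
    case False
    with less.prems have "\<not> irred_on a S" by blast
    then obtain Q where Q: "Q \<noteq> {}" "Q \<subset> S" "\<And>i j. i \<in> S - Q \<Longrightarrow> j \<in> Q \<Longrightarrow> a i j = 0"
      by (rule not_irred_onD) blast
    \<comment> \<open>Otherwise \<open>I \<inter> Q\<close> would be a splitting of the irreducible
      set \<open>I\<close>.\<close>
    have "I \<subseteq> Q \<or> I \<subseteq> S - Q"
    proof (rule ccontr)
      assume "\<not> ?thesis"
      then have "I \<inter> Q \<noteq> {}" "I \<inter> Q \<subset> I" using less.prems(2) by auto
      then obtain i j where "i \<in> I - I \<inter> Q" "j \<in> I \<inter> Q" "a i j \<noteq> 0"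
        by (rule irred_onD[OF assms(3)])
      with Q(3)[of i j] less.prems(2) show False by blast
    qed
    moreover have "singular_on a R" if "I \<subseteq> R" "R \<subset> S" for R
    proof (rule less.hyps)
      show "card R < card S" using that less.prems(1) by (simp add: psubset_card_mono)
      show "finite R" using that less.prems(1) by (meson finite_subset psubset_imp_subset)
      show "\<not> irred_on a T" if "I \<subset> T" "T \<subseteq> R" for T
        using less.prems(3)[of T] that \<open>R \<subset> S\<close> by blast
    qed fact
    moreover have "Q \<subset> S" "S - Q \<subset> S" using Q by auto
    ultimately have "singular_on a Q \<or> singular_on a (S - Q)" by blast
    moreover have "singular_on a S" if "singular_on a Q"
      by (rule singular_on_leading_block[OF less.prems(1) _ Q(3) that]) (use Q(2) in auto)
    moreover have "singular_on a S" if "singular_on a (S - Q)"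
      by (rule singular_on_trailing_block[OF less.prems(1) _ Q(3) that]) (use Q(2) in auto)
    ultimately show ?thesis by blast
  next
    case True
    show ?thesis using assms(2) by (simp only: True)
  qed
qed

section \<open>H-matrices\<close>

lemma pow_smult_mat:
  assumes "(A :: 'a::comm_semiring_1 mat) \<in> carrier_mat n n"
  shows "(c \<cdot>\<^sub>m A) ^\<^sub>m k = c ^ k \<cdot>\<^sub>m A ^\<^sub>m k"
proof (induction k)
  case 0
  show ?case using assms by auto
next
  case (Suc k)
  have "A ^\<^sub>m k \<in> carrier_mat n n" using assms by simp
  then show ?case
    using assms Suc by (simp add: mult_smult_distrib[of _ n n _ n] mult_smult_assoc_mat[of _ n n _ n] mult.assoc mult.commute) (auto simp: mult_ac intro!: eq_matI)
qed

text \<open>Scaling by \<open>1 / r\<close> brings the spectral radius below 1, where the Jordan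
  normal form bounds all powers by a single constant; scaling back produces the factor
  \<open>r ^ k\<close>.\<close>

lemma spectral_radius_power_bound:
  assumes C: "C \<in> carrier_mat n n" and r: "spectral_radius C < r" "0 < r"
  shows "\<exists>c. \<forall>k. \<forall>i<n. \<forall>j<n. cmod ((C ^\<^sub>m k) $$ (i, j)) \<le> c * r ^ k"
proof (cases "n = 0")
  case False
  define D where "D = complex_of_real (1 / r) \<cdot>\<^sub>m C"
  have D: "D \<in> carrier_mat n n" using C by (simp add: D_def)
  \<comment> \<open>An eigenvalue of \<open>D\<close> of maximal modulus, multiplied by
    \<open>r\<close>, is an eigenvalue of \<open>C\<close>; this transfers the bound on the spectral
    radius from \<open>C\<close> to \<open>D\<close>.\<close>
  from spectral_radius_mem_max(1)[OF D] False obtain e where e: "eigenvalue D e" "spectral_radius D = cmod e"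
    by (auto simp: spectrum_def)
  then obtain v where v: "v \<in> carrier_vec n" "v \<noteq> 0\<^sub>v n" "D *\<^sub>v v = e \<cdot>\<^sub>v v"
    using D unfolding eigenvalue_def eigenvector_def by auto
  have CD: "C = complex_of_real r \<cdot>\<^sub>m D" using r C by (intro eq_matI) (auto simp: D_def)
  have "C *\<^sub>v v = complex_of_real r \<cdot>\<^sub>v (D *\<^sub>v v)"
    unfolding CD using D v(1) by (intro eq_vecI) auto
  also have "\<dots> = (complex_of_real r * e) \<cdot>\<^sub>v v" by (simp add: v(3) smult_smult_assoc)
  finally have "eigenvalue C (complex_of_real r * e)"
    using C v unfolding eigenvalue_def eigenvector_def by auto
  then have le: "cmod (complex_of_real r * e) \<le> spectral_radius C"
    using spectral_radius_mem_max(2)[OF C] False by (auto simp: spectrum_def)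
  have "cmod (complex_of_real r * e) = r * cmod e" using r by (simp add: norm_mult)
  with le r(1) have "r * cmod e < r" by linarith
  then have "spectral_radius D < 1" using r(2) e(2) by (simp add: mult_less_cancel_left2)
  from spectral_radius_jnf_norm_bound_less_1_upper_triangular[OF D this]
  obtain c where c: "\<And>k. norm_bound (D ^\<^sub>m k) c" by blast
  have "cmod ((C ^\<^sub>m k) $$ (i, j)) \<le> c * r ^ k" if "i < n" "j < n" for k i j
  proof -
    have "C ^\<^sub>m k \<in> carrier_mat n n" using C by simp
    then have "cmod (complex_of_real (1 / r) ^ k * (C ^\<^sub>m k) $$ (i, j)) \<le> c"
      using c[of k] that C unfolding norm_bound_def D_def by (simp add: pow_smult_mat[OF C])
    then have "cmod ((C ^\<^sub>m k) $$ (i, j)) / r ^ k \<le> c"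
      using r by (simp add: norm_mult norm_power norm_divide power_divide)
    then show ?thesis using r by (simp add: divide_le_eq)
  qed
  then show ?thesis by blast
qed simp

text \<open>The Collatz-Wielandt lower bound. Iterating B v >= r v gives B^k v >= r^k v, since
  \<open>B\<close> is nonnegative. A spectral radius below \<open>r\<close> would bound the entries
  of B^k by a multiple of q^k for some q < r, which is too slow.\<close>

lemma spectral_radius_no_growth:
  assumes B: "B \<in> carrier_mat n n" and pos: "\<And>i j. i < n \<Longrightarrow> j < n \<Longrightarrow> 0 \<le> B $$ (i, j)"
    and v: "\<And>i. i < n \<Longrightarrow> 0 \<le> v i" "\<exists>i<n. 0 < v i"
    and grow: "\<And>i. i < n \<Longrightarrow> r * v i \<le> (\<Sum>j<n. B $$ (i, j) * v j)" and r: "0 < r"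
  shows "r \<le> spectral_radius (map_mat complex_of_real B)"
proof (rule ccontr)
  define C where "C = map_mat complex_of_real B"
  assume "\<not> r \<le> spectral_radius (map_mat complex_of_real B)"
  then have lt: "spectral_radius C < r" by (simp add: C_def)
  have C: "C \<in> carrier_mat n n" using B by (simp add: C_def)
  \<comment> \<open>The maximum with 0 makes \<open>q\<close> positive, as the power bound and the
    later division by \<open>q\<close> require.\<close>
  obtain q where q: "max 0 (spectral_radius C) < q" "q < r"
    using dense[of "max 0 (spectral_radius C)" r] lt r by auto
  from spectral_radius_power_bound[OF C, of q] q
  obtain c where c: "\<And>k i j. i < n \<Longrightarrow> j < n \<Longrightarrow> cmod ((C ^\<^sub>m k) $$ (i, j)) \<le> c * q ^ k" by auto
  have Bk: "B ^\<^sub>m k \<in> carrier_mat n n" for k using B by simp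
  have Ck: "C ^\<^sub>m k = map_mat complex_of_real (B ^\<^sub>m k)" for k
    unfolding C_def by (rule of_real_hom.mat_hom_pow[OF B, symmetric])
  have step: "(B ^\<^sub>m Suc k) $$ (i, j) = (\<Sum>l<n. (B ^\<^sub>m k) $$ (i, l) * B $$ (l, j))" if "i < n" "j < n" for k i j
    using that B Bk[of k] by (auto simp: scalar_prod_def atLeast0LessThan intro!: sum.cong)
  have pk: "0 \<le> (B ^\<^sub>m k) $$ (i, j)" if "i < n" "j < n" for k i j
    using that
  proof (induction k arbitrary: i j)
    case 0
    then show ?case using B by simp
  next
    case (Suc k)
    then show ?case using pos by (simp add: step del: pow_mat.simps) (auto intro!: sum_nonneg)
  qed
  \<comment> \<open>These are the entries of B^k v, to be caught between \<open>r ^ k * v i\<close>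
    and a multiple of \<open>q ^ k\<close>.\<close>
  define g where "g k i = (\<Sum>j<n. (B ^\<^sub>m k) $$ (i, j) * v j)" for k i
  have lower: "r ^ k * v i \<le> g k i" if "i < n" for k i
  proof (induction k)
    case 0
    have "g 0 i = (\<Sum>j<n. if j = i then v i else 0)"
      unfolding g_def using B that by (intro sum.cong) auto
    with that show ?case by simp
  next
    case (Suc k)
    have "r ^ Suc k * v i \<le> r * g k i" using Suc r by simp
    also have "\<dots> = (\<Sum>l<n. (B ^\<^sub>m k) $$ (i, l) * (r * v l))"
      by (simp add: g_def sum_distrib_left algebra_simps)
    also have "\<dots> \<le> (\<Sum>l<n. (B ^\<^sub>m k) $$ (i, l) * (\<Sum>j<n. B $$ (l, j) * v j))"
      using pk that grow by (intro sum_mono mult_left_mono) auto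
    also have "\<dots> = (\<Sum>l<n. \<Sum>j<n. (B ^\<^sub>m k) $$ (i, l) * B $$ (l, j) * v j)"
      by (simp add: sum_distrib_left mult.assoc)
    also have "\<dots> = (\<Sum>j<n. \<Sum>l<n. (B ^\<^sub>m k) $$ (i, l) * B $$ (l, j) * v j)" by (rule sum.swap)
    also have "\<dots> = g (Suc k) i"
      unfolding g_def using that by (intro sum.cong) (simp_all add: step sum_distrib_right del: pow_mat.simps)
    finally show ?case .
  qed
  have upper: "g k i \<le> c * (\<Sum>j<n. v j) * q ^ k" if "i < n" for k i
  proof -
    have "(B ^\<^sub>m k) $$ (i, j) \<le> c * q ^ k" if "j < n" for j
      using c[OF \<open>i < n\<close> that, of k] carrier_matD[OF Bk[of k]] \<open>i < n\<close> that
      by (simp add: Ck pk)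
    then have "g k i \<le> (\<Sum>j<n. c * q ^ k * v j)"
      unfolding g_def using v(1) by (intro sum_mono mult_right_mono) auto
    then show ?thesis by (simp add: sum_distrib_left sum_distrib_right algebra_simps)
  qed
  from v(2) obtain i where i: "i < n" "0 < v i" by blast
  have "1 < r / q" using q by simp
  from real_arch_pow[OF this] obtain k where "c * (\<Sum>j<n. v j) / v i < (r / q) ^ k" by blast
  then have "c * (\<Sum>j<n. v j) * q ^ k < r ^ k * v i"
    using i q by (simp add: field_simps)
  also have "\<dots> \<le> c * (\<Sum>j<n. v j) * q ^ k" using lower[OF i(1)] upper[OF i(1)] order_trans by blast
  finally show False by simp
qed

text \<open>Write \<mu>(A) = s I - B and extend \<open>u\<close> by zero to \<open>v\<close>. Strict
  excess on \<open>S\<close> leaves room for some t > 0 with B v >= (s + t) v, so the spectral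
  radius of \<open>B\<close> would be at least s + t, whereas it is at most
  \<open>s\<close>.\<close>

lemma H_matrix_no_strict_excess:
  assumes A: "A \<in> H_matrices n" and S: "S \<subseteq> {..<n}" "S \<noteq> {}"
    and u: "\<And>i. i \<in> S \<Longrightarrow> 0 \<le> u i"
    and ex: "\<And>i. i \<in> S \<Longrightarrow> 0 < excess (\<lambda>i j. cmod (A $$ (i, j))) S u i"
  shows False
proof -
  have fin: "finite S" using S finite_subset by blast
  from A have Ac: "A \<in> carrier_mat n n" by (simp add: H_matrices_def)
  from A obtain s B where B: "B \<in> carrier_mat n n" "\<And>i j. i < n \<Longrightarrow> j < n \<Longrightarrow> 0 \<le> B $$ (i, j)"
    and sr: "spectral_radius (map_mat complex_of_real B) \<le> s"
    and eq: "comparison_mat A = s \<cdot>\<^sub>m 1\<^sub>m n - B"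
    unfolding H_matrices_def M_matrix_def by blast
  have n: "0 < n" using S by auto
  have off: "B $$ (i, j) = (if i = j then s - cmod (A $$ (i, j)) else cmod (A $$ (i, j)))"
    if "i < n" "j < n" for i j
  proof -
    have "comparison_mat A $$ (i, j) = (s \<cdot>\<^sub>m 1\<^sub>m n - B) $$ (i, j)" by (simp add: eq)
    then show ?thesis using that Ac B(1) by (auto simp: comparison_mat_def split: if_splits)
  qed
  \<comment> \<open>A spectral radius is the modulus of an eigenvalue, and one exists because
    \<open>n\<close> is positive.\<close>
  have s: "0 \<le> s"
  proof -
    have "spectral_radius (map_mat complex_of_real B) \<in> norm ` spectrum (map_mat complex_of_real B)"
      using spectral_radius_mem_max(1)[of "map_mat complex_of_real B" n] B(1) n by simp
    then have "0 \<le> spectral_radius (map_mat complex_of_real B)" by auto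
    with sr show ?thesis by simp
  qed
  define e where "e = excess (\<lambda>i j. cmod (A $$ (i, j))) S u"
  define m where "m = Min (e ` S)"
  have m: "0 < m" "\<And>i. i \<in> S \<Longrightarrow> m \<le> e i"
    using fin S(2) ex by (auto simp: m_def e_def)
  \<comment> \<open>The smallest excess \<open>m\<close> is spread over the total weight; since
    \<open>u i\<close> is at most \<open>sum u S\<close>, this gives
    \<open>t * u i \<le> e i\<close> in every row.\<close>
  define t where "t = m / (1 + sum u S)"
  have su: "0 \<le> sum u S" using u by (simp add: sum_nonneg)
  have t: "0 < t" using m su by (simp add: t_def)
  have tu: "t * u i \<le> e i" if "i \<in> S" for i
  proof -
    have "u i \<le> sum u S" using fin u that by (intro member_le_sum) auto
    then have "t * u i \<le> t * (1 + sum u S)" using t by (intro mult_left_mono) auto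
    also have "\<dots> = m" using su by (simp add: t_def)
    finally show ?thesis using m(2)[OF that] by simp
  qed
  define v where "v i = (if i \<in> S then u i else 0)" for i
  have Bv: "(\<Sum>j<n. B $$ (i, j) * v j) = e i + s * u i" if "i \<in> S" for i
  proof -
    have i: "i < n" using that S by auto
    have "(\<Sum>j<n. B $$ (i, j) * v j) = (\<Sum>j\<in>S. B $$ (i, j) * u j)"
      using S(1) by (intro sum.mono_neutral_cong_right) (auto simp: v_def)
    also have "\<dots> = B $$ (i, i) * u i + (\<Sum>j\<in>S - {i}. B $$ (i, j) * u j)"
      by (rule sum.remove[OF fin that])
    also have "(\<Sum>j\<in>S - {i}. B $$ (i, j) * u j) = (\<Sum>j\<in>S - {i}. cmod (A $$ (i, j)) * u j)"
      using i S(1) by (intro sum.cong) (auto simp: off)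
    finally show ?thesis using i by (simp add: off e_def excess_def algebra_simps)
  qed
  have "s + t \<le> spectral_radius (map_mat complex_of_real B)"
  proof (rule spectral_radius_no_growth[OF B])
    show "0 \<le> v i" for i using u by (simp add: v_def)
    show "(s + t) * v i \<le> (\<Sum>j<n. B $$ (i, j) * v j)" if "i < n" for i
    proof (cases "i \<in> S")
      case True
      then have "(s + t) * v i \<le> e i + s * u i" using tu[OF True] by (simp add: v_def algebra_simps)
      then show ?thesis by (simp add: Bv[OF True])
    next
      case False
      then show ?thesis using B(2) that u by (auto simp: v_def intro!: sum_nonneg)
    qed
    show "0 < s + t" using s t by simp
    \<comment> \<open>If all weights vanished, every excess would be zero and not strict.\<close>
    show "\<exists>i<n. 0 < v i"
    proof (rule ccontr)
      assume c: "\<not> ?thesis"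
      have "u i = 0" if "i \<in> S" for i
      proof -
        have "i < n" using that S by auto
        then have "v i \<le> 0" using c not_less by blast
        then show ?thesis using u[OF that] that by (simp add: v_def)
      qed
      moreover obtain i where "i \<in> S" using S(2) by blast
      ultimately have "e i = 0" by (simp add: e_def excess_def)
      with ex[OF \<open>i \<in> S\<close>] show False by (simp add: e_def)
    qed
  qed
  with sr t show False by simp
qed

section \<open>The backward Gauss-Seidel iteration\<close>

lemma mat_inv:
  assumes M: "M \<in> carrier_mat n n" and det: "det M \<noteq> 0"
  shows "mat_inv M \<in> carrier_mat n n" "M * mat_inv M = 1\<^sub>m n" "mat_inv M * M = 1\<^sub>m n"
proof -
  have "M \<in> Units (ring_mat TYPE(complex) n ())" by (rule det_non_zero_imp_unit[OF M det])
  then obtain B where "mat_inverse M = Some B"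
    using mat_inverse(1)[OF M, of "()"] by (cases "mat_inverse M") auto
  with mat_inverse(2)[OF M this]
  show "mat_inv M \<in> carrier_mat n n" "M * mat_inv M = 1\<^sub>m n" "mat_inv M * M = 1\<^sub>m n"
    by (auto simp: mat_inv_def)
qed

lemma mult_mat_vec_index:
  assumes "M \<in> carrier_mat n n" "v \<in> carrier_vec n" "i < n"
  shows "(M *\<^sub>v v) $ i = (\<Sum>j<n. M $$ (i, j) * v $ j)"
  using assms by (auto simp: scalar_prod_def atLeast0LessThan intro!: sum.cong)

text \<open>The entries of z (D - U) - L. The minus signs in \<open>lower_part\<close> and
  \<open>upper_part\<close> cancel, so each entry is that of \<open>A\<close>, scaled by
  \<open>z\<close> on and above the diagonal.\<close>

definition bgs_pencil :: "complex mat \<Rightarrow> complex \<Rightarrow> nat \<Rightarrow> nat \<Rightarrow> complex" where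
  "bgs_pencil A z i j = (if j < i then A $$ (i, j) else z * A $$ (i, j))"

text \<open>Positive dimension gives a nonempty spectrum, and the nonzero diagonal makes the
  triangular matrix D - U invertible.\<close>

locale bgs =
  fixes n :: nat and A :: "complex mat"
  assumes n: "0 < n" and A: "A \<in> carrier_mat n n"
    and diag: "\<And>i. i < n \<Longrightarrow> A $$ (i, i) \<noteq> 0"
begin

definition M :: "complex mat" where "M = diag_part A - upper_part A"

abbreviation "L \<equiv> lower_part A"
abbreviation "N \<equiv> mat_inv M"
abbreviation "H \<equiv> BGS_mat A"

lemma M_carrier: "M \<in> carrier_mat n n"
  using A by (auto simp: M_def diag_part_def upper_part_def mat_diag_def)

lemma L_carrier: "L \<in> carrier_mat n n"
  using A by (auto simp: lower_part_def)

lemma M_index: "i < n \<Longrightarrow> j < n \<Longrightarrow> M $$ (i, j) = (if j < i then 0 else A $$ (i, j))"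
  using A by (auto simp: M_def diag_part_def upper_part_def mat_diag_def)

lemma L_index: "i < n \<Longrightarrow> j < n \<Longrightarrow> L $$ (i, j) = (if j < i then - A $$ (i, j) else 0)"
  using A by (auto simp: lower_part_def)

lemma det_M: "det M \<noteq> 0"
proof -
  have "upper_triangular M" using carrier_matD[OF M_carrier] by (auto simp: M_index intro!: upper_triangularI)
  then have "det M = prod_list (diag_mat M)" using M_carrier by (rule det_upper_triangular)
  moreover have "0 \<notin> set (diag_mat M)"
    using carrier_matD[OF M_carrier] diag M_index by (force simp: diag_mat_def)
  ultimately show ?thesis by (simp add: prod_list_zero_iff)
qed

lemmas N_inverse = mat_inv[OF M_carrier det_M]

lemma H_eq_N_L: "H = N * L"
  by (simp add: BGS_mat_def M_def)

lemma H_carrier: "H \<in> carrier_mat n n"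
  unfolding H_eq_N_L using N_inverse(1) L_carrier by simp

lemma M_H: "v \<in> carrier_vec n \<Longrightarrow> M *\<^sub>v (H *\<^sub>v v) = L *\<^sub>v v"
proof -
  assume v: "v \<in> carrier_vec n"
  have "M *\<^sub>v (H *\<^sub>v v) = (M * H) *\<^sub>v v" by (rule assoc_mult_mat_vec[symmetric, OF M_carrier H_carrier v])
  also have "M * H = (M * N) * L" unfolding H_eq_N_L by (rule assoc_mult_mat[symmetric, OF M_carrier N_inverse(1) L_carrier])
  also have "\<dots> = L" using N_inverse(2) L_carrier by simp
  finally show ?thesis .
qed

lemma N_M: "v \<in> carrier_vec n \<Longrightarrow> N *\<^sub>v (M *\<^sub>v v) = v"
  using assoc_mult_mat_vec[OF N_inverse(1) M_carrier, of v] N_inverse(3) by simp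

lemma H_eq: "v \<in> carrier_vec n \<Longrightarrow> H *\<^sub>v v = N *\<^sub>v (L *\<^sub>v v)"
  unfolding H_eq_N_L using assoc_mult_mat_vec[OF N_inverse(1) L_carrier, of v] by simp

lemma A_M_L: "v \<in> carrier_vec n \<Longrightarrow> A *\<^sub>v v = M *\<^sub>v v - L *\<^sub>v v"
proof -
  assume v: "v \<in> carrier_vec n"
  have "A = M - L"
  proof (rule eq_matI)
    fix i j assume "i < dim_row (M - L)" "j < dim_col (M - L)"
    then have ij: "i < n" "j < n" using L_carrier by auto
    then have "(M - L) $$ (i, j) = M $$ (i, j) - L $$ (i, j)" using L_carrier by simp
    then show "A $$ (i, j) = (M - L) $$ (i, j)" using ij by (simp only: M_index L_index) auto
  qed (use A L_carrier in auto)
  then show ?thesis using minus_mult_distrib_mat_vec[OF M_carrier L_carrier v] by simp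
qed

text \<open>Since \<open>M\<close> is invertible, \<open>H\<close> v = z v can be multiplied by
  \<open>M\<close> to give L v = z M v, a statement about the entries of \<open>A\<close> in which
  no inverse occurs.\<close>

lemma eigenvalue_iff:
  "eigenvalue H z \<longleftrightarrow> singular_on (bgs_pencil A z) {..<n}"
proof -
  have iff: "H *\<^sub>v v = z \<cdot>\<^sub>v v \<longleftrightarrow> (\<forall>i<n. (\<Sum>j<n. bgs_pencil A z i j * v $ j) = 0)"
    if v: "v \<in> carrier_vec n" for v
  proof -
    have "H *\<^sub>v v = z \<cdot>\<^sub>v v \<longleftrightarrow> M *\<^sub>v (H *\<^sub>v v) = M *\<^sub>v (z \<cdot>\<^sub>v v)"
    proof
      assume "M *\<^sub>v (H *\<^sub>v v) = M *\<^sub>v (z \<cdot>\<^sub>v v)"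
      then have "N *\<^sub>v (M *\<^sub>v (H *\<^sub>v v)) = N *\<^sub>v (M *\<^sub>v (z \<cdot>\<^sub>v v))" by simp
      then show "H *\<^sub>v v = z \<cdot>\<^sub>v v" using N_M[of "H *\<^sub>v v"] N_M[of "z \<cdot>\<^sub>v v"] H_carrier v by simp
    qed simp
    also have "\<dots> \<longleftrightarrow> L *\<^sub>v v = z \<cdot>\<^sub>v (M *\<^sub>v v)"
      using M_H[OF v] mult_mat_vec[OF M_carrier v, of z] by simp
    also have "\<dots> \<longleftrightarrow> (\<forall>i<n. (L *\<^sub>v v) $ i = z * (M *\<^sub>v v) $ i)"
      using carrier_matD[OF L_carrier] carrier_matD[OF M_carrier] by (auto simp: vec_eq_iff)
    also have "\<dots> \<longleftrightarrow> (\<forall>i<n. z * (\<Sum>j<n. M $$ (i, j) * v $ j) - (\<Sum>j<n. L $$ (i, j) * v $ j) = 0)"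
      using mult_mat_vec_index[OF L_carrier v] mult_mat_vec_index[OF M_carrier v] by auto
    also have "\<dots> \<longleftrightarrow> (\<forall>i<n. (\<Sum>j<n. bgs_pencil A z i j * v $ j) = 0)"
    proof -
      have "z * (\<Sum>j<n. M $$ (i, j) * v $ j) - (\<Sum>j<n. L $$ (i, j) * v $ j)
          = (\<Sum>j<n. bgs_pencil A z i j * v $ j)" if "i < n" for i
        unfolding sum_distrib_left sum_subtractf[symmetric]
        by (intro sum.cong refl) (use that in \<open>auto simp: M_index L_index bgs_pencil_def\<close>)
      then show ?thesis by simp
    qed
    finally show ?thesis .
  qed
  show ?thesis
  proof
    assume "eigenvalue H z"
    then obtain v where v: "v \<in> carrier_vec n" "v \<noteq> 0\<^sub>v n" "H *\<^sub>v v = z \<cdot>\<^sub>v v"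
      using carrier_matD[OF H_carrier] unfolding eigenvalue_def eigenvector_def by auto
    have "\<exists>i<n. v $ i \<noteq> 0" using v(1,2) by (auto simp: vec_eq_iff)
    with v iff[OF v(1)] show "singular_on (bgs_pencil A z) {..<n}"
      unfolding singular_on_def by (intro exI[of _ "\<lambda>i. v $ i"]) auto
  next
    assume "singular_on (bgs_pencil A z) {..<n}"
    then obtain x where x: "\<exists>i<n. x i \<noteq> 0" "\<forall>i<n. (\<Sum>j<n. bgs_pencil A z i j * x j) = 0"
      unfolding singular_on_def by auto
    have "H *\<^sub>v vec n x = z \<cdot>\<^sub>v vec n x" using x(2) by (subst iff) auto
    moreover have "vec n x \<noteq> 0\<^sub>v n" using x(1) by (auto simp: vec_eq_iff)
    ultimately show "eigenvalue H z"
      using carrier_matD[OF H_carrier] unfolding eigenvalue_def eigenvector_def by (intro exI[of _ "vec n x"]) auto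
  qed
qed

lemma spectral_radius_less_1_iff:
  "spectral_radius H < 1 \<longleftrightarrow> (\<forall>z. eigenvalue H z \<longrightarrow> cmod z < 1)"
proof
  assume "spectral_radius H < 1"
  then show "\<forall>z. eigenvalue H z \<longrightarrow> cmod z < 1"
    using spectral_radius_mem_max(2)[OF H_carrier n] by (force simp: spectrum_def)
next
  assume "\<forall>z. eigenvalue H z \<longrightarrow> cmod z < 1"
  then show "spectral_radius H < 1"
    using spectral_radius_mem_max(1)[OF H_carrier n] by (auto simp: spectrum_def)
qed

section \<open>Error propagation and convergence of the iteration\<close>

lemma fixed_point:
  assumes "x \<in> carrier_vec n" "b \<in> carrier_vec n" "A *\<^sub>v x = b"
  shows "H *\<^sub>v x + N *\<^sub>v b = x"
proof -
  have c: "M *\<^sub>v x \<in> carrier_vec n" "L *\<^sub>v x \<in> carrier_vec n"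
    using M_carrier L_carrier assms(1) by (auto intro: mult_mat_vec_carrier)
  have "q + (p - q) = p" if "p \<in> carrier_vec n" "q \<in> carrier_vec n" for p q :: "complex vec"
    using that by (intro eq_vecI) auto
  from this[OF c] have "L *\<^sub>v x + b = M *\<^sub>v x" using assms(3) A_M_L[OF assms(1)] by simp
  then have "N *\<^sub>v (L *\<^sub>v x) + N *\<^sub>v b = N *\<^sub>v (M *\<^sub>v x)"
    using mult_add_distrib_mat_vec[OF N_inverse(1) c(2) assms(2)] by simp
  then show ?thesis using N_M H_eq assms(1) by simp
qed

text \<open>The solution \<open>x\<close> is a fixed point of the recursion, so \<open>b\<close>
  drops out of the error and each step multiplies the error by \<open>H\<close>.\<close>

lemma BGS_seq_error:
  assumes x: "x \<in> carrier_vec n" and b: "b \<in> carrier_vec n" and sol: "A *\<^sub>v x = b"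
    and d: "d \<in> carrier_vec n"
  shows "BGS_seq A b (x + d) m = x + H ^\<^sub>m m *\<^sub>v d"
proof (induction m)
  case 0
  show ?case using d carrier_matD[OF H_carrier] by simp
next
  case (Suc m)
  have Hm: "H ^\<^sub>m m \<in> carrier_mat n n" using H_carrier by simp
  then have Hd: "H ^\<^sub>m m *\<^sub>v d \<in> carrier_vec n" using d by simp
  \<comment> \<open>Matrix powers grow by a factor on the right, the iteration by a factor on the
    left.\<close>
  have comm: "H * H ^\<^sub>m m = H ^\<^sub>m Suc m"
  proof (induction m)
    case 0
    then show ?case using H_carrier by simp
  next
    case (Suc m)
    have "H * H ^\<^sub>m Suc m = (H * H ^\<^sub>m m) * H"
      using assoc_mult_mat[OF H_carrier _ H_carrier, of "H ^\<^sub>m m"] H_carrier by simp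
    with Suc show ?case by simp
  qed
  have "BGS_seq A b (x + d) (Suc m) = H *\<^sub>v x + H *\<^sub>v (H ^\<^sub>m m *\<^sub>v d) + N *\<^sub>v b"
    using Suc mult_add_distrib_mat_vec[OF H_carrier x Hd] by (simp add: M_def)
  also have "\<dots> = (H *\<^sub>v x + N *\<^sub>v b) + H *\<^sub>v (H ^\<^sub>m m *\<^sub>v d)"
    using H_carrier N_inverse(1) by (intro eq_vecI) auto
  also have "\<dots> = x + H ^\<^sub>m Suc m *\<^sub>v d"
    unfolding fixed_point[OF x b sol] using assoc_mult_mat_vec[OF H_carrier Hm d] comm by simp
  finally show ?case .
qed

lemma powers_tendsto_0:
  assumes "spectral_radius H < 1" "d \<in> carrier_vec n" "j < n"
  shows "(\<lambda>m. (H ^\<^sub>m m *\<^sub>v d) $ j) \<longlonglongrightarrow> 0"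
proof -
  obtain r where r: "max 0 (spectral_radius H) < r" "r < 1"
    using dense[of "max 0 (spectral_radius H)" 1] assms(1) by auto
  from spectral_radius_power_bound[OF H_carrier, of r] r
  obtain c where c: "\<And>k i j. i < n \<Longrightarrow> j < n \<Longrightarrow> cmod ((H ^\<^sub>m k) $$ (i, j)) \<le> c * r ^ k" by auto
  have "(\<lambda>k. c * r ^ k) \<longlonglongrightarrow> c * 0"
    using r by (intro tendsto_mult tendsto_const LIMSEQ_power_zero) auto
  then have lim: "(\<lambda>k. c * r ^ k) \<longlonglongrightarrow> 0" by simp
  have "(\<lambda>m. (H ^\<^sub>m m) $$ (j, i)) \<longlonglongrightarrow> 0" if "i < n" for i
    by (rule tendsto_0_le[OF lim, of _ 1]) (use c[OF assms(3) that] in \<open>auto intro!: always_eventually order_trans[OF _ abs_ge_self]\<close>)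
  then have "(\<lambda>m. \<Sum>i<n. (H ^\<^sub>m m) $$ (j, i) * d $ i) \<longlonglongrightarrow> (\<Sum>i<n. 0 * d $ i)"
    by (intro tendsto_sum tendsto_mult tendsto_const) auto
  then show ?thesis
    using mult_mat_vec_index[OF _ assms(2,3), of "H ^\<^sub>m _"] H_carrier by simp
qed

text \<open>If the iteration converges, starting it at \<open>x\<close> plus an eigenvector for
  \<open>z\<close> makes the error \<open>z ^ m\<close> times that vector, so |z| < 1. Conversely,
  powers of \<open>H\<close> tend to zero, and the unique solution exists because \<open>A\<close>
  is invertible.\<close>

lemma BGS_convergent_iff:
  assumes b: "b \<in> carrier_vec n"
  shows "BGS_convergent n A b \<longleftrightarrow> spectral_radius H < 1"
proof
  assume "BGS_convergent n A b"
  then obtain x where x: "x \<in> carrier_vec n" "A *\<^sub>v x = b"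
    and lim: "\<And>x0 j. x0 \<in> carrier_vec n \<Longrightarrow> j < n \<Longrightarrow> (\<lambda>m. BGS_seq A b x0 m $ j) \<longlonglongrightarrow> x $ j"
    unfolding BGS_convergent_def by blast
  show "spectral_radius H < 1"
    unfolding spectral_radius_less_1_iff
  proof (intro allI impI)
    fix z assume "eigenvalue H z"
    then obtain v where ev: "eigenvector H v z" unfolding eigenvalue_def by blast
    then have v: "v \<in> carrier_vec n" "v \<noteq> 0\<^sub>v n"
      using carrier_matD[OF H_carrier] unfolding eigenvector_def by auto
    then obtain j where j: "j < n" "v $ j \<noteq> 0" by (auto simp: vec_eq_iff)
    have "BGS_seq A b (x + v) m $ j = x $ j + z ^ m * v $ j" for m
      unfolding BGS_seq_error[OF x(1) b x(2) v(1)] eigenvector_pow[OF H_carrier ev] using x(1) v(1) j(1) by simp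
    then have "(\<lambda>m. x $ j + z ^ m * v $ j) \<longlonglongrightarrow> x $ j"
      using lim[of "x + v" j] x v j by simp
    then have "(\<lambda>m. (x $ j + z ^ m * v $ j - x $ j) / v $ j) \<longlonglongrightarrow> (x $ j - x $ j) / v $ j"
      by (intro tendsto_divide tendsto_diff tendsto_const) (use j in auto)
    then have "(\<lambda>m. z ^ m) \<longlonglongrightarrow> 0" using j by simp
    then have "(\<lambda>m. cmod (z ^ m)) \<longlonglongrightarrow> 0" by (rule tendsto_norm_zero)
    then have "\<forall>\<^sub>F m in sequentially. cmod (z ^ m) < 1" by (rule order_tendstoD) simp
    then obtain m where "cmod (z ^ m) < 1" by (auto simp: eventually_sequentially)
    then show "cmod z < 1" using one_le_power[of "cmod z" m] by (metis norm_power not_less)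
  qed
next
  assume r: "spectral_radius H < 1"
  \<comment> \<open>A null vector of \<open>A\<close> solves the system with right-hand side 0,
    hence is a fixed point of \<open>H\<close>; then 1 would be an eigenvalue.\<close>
  have "det A \<noteq> 0"
  proof
    assume "det A = 0"
    then obtain v where v: "v \<in> carrier_vec n" "v \<noteq> 0\<^sub>v n" "A *\<^sub>v v = 0\<^sub>v n"
      using det_0_iff_vec_prod_zero[OF A] by blast
    have "H *\<^sub>v v + N *\<^sub>v 0\<^sub>v n = v" by (rule fixed_point[OF v(1) _ v(3)]) simp
    moreover have "N *\<^sub>v 0\<^sub>v n = 0\<^sub>v n" using carrier_matD[OF N_inverse(1)] by (intro eq_vecI) (auto intro!: scalar_prod_right_zero carrier_vecI)
    ultimately have "H *\<^sub>v v = 1 \<cdot>\<^sub>v v" using H_carrier v(1) by simp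
    then have "eigenvalue H 1"
      using v carrier_matD[OF H_carrier] unfolding eigenvalue_def eigenvector_def by auto
    with r show False by (auto simp: spectral_radius_less_1_iff)
  qed
  note inv = mat_inv[OF A this]
  define x where "x = mat_inv A *\<^sub>v b"
  have x: "x \<in> carrier_vec n" using inv(1) b by (simp add: x_def)
  have sol: "A *\<^sub>v x = b"
    unfolding x_def using assoc_mult_mat_vec[OF A inv(1) b] inv(2) b by simp
  have uniq: "y = x" if "y \<in> carrier_vec n" "A *\<^sub>v y = b" for y
    using assoc_mult_mat_vec[OF inv(1) A that(1)] inv(3) that by (simp add: x_def)
  have "(\<lambda>m. BGS_seq A b x0 m $ j) \<longlonglongrightarrow> x $ j" if x0: "x0 \<in> carrier_vec n" and j: "j < n" for x0 j
  proof -
    have d: "x0 - x \<in> carrier_vec n" using x0 x by simp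
    have "x0 = x + (x0 - x)" using x0 x by (intro eq_vecI) auto
    then have eq: "BGS_seq A b x0 m = x + H ^\<^sub>m m *\<^sub>v (x0 - x)" for m
      using BGS_seq_error[OF x b sol d, of m] by simp
    have dim: "dim_vec (H ^\<^sub>m m *\<^sub>v (x0 - x)) = n" for m using carrier_matD[OF H_carrier] by simp
    have "(\<lambda>m. x $ j + (H ^\<^sub>m m *\<^sub>v (x0 - x)) $ j) \<longlonglongrightarrow> x $ j + 0"
      by (intro tendsto_add tendsto_const powers_tendsto_0 r d j)
    moreover have "BGS_seq A b x0 m $ j = x $ j + (H ^\<^sub>m m *\<^sub>v (x0 - x)) $ j" for m
      unfolding eq using dim j by (intro index_add_vec) simp
    ultimately show ?thesis by simp
  qed
  with x sol uniq show "BGS_convergent n A b" unfolding BGS_convergent_def by blast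
qed

end

section \<open>Critical index sets\<close>

text \<open>The equality case of the triangle inequality. After rotation by the conjugate of
  \<open>w\<close>, the nonnegative numbers \<open>cmod (g j) - Re (g j)\<close> sum to zero, so
  each \<open>g j\<close> is a nonnegative real.\<close>

lemma norm_sum_eq_imp_aligned:
  fixes f :: "'b \<Rightarrow> complex"
  assumes fin: "finite F" and w: "cmod w = 1"
    and eq: "(\<Sum>j\<in>F. f j) = w * complex_of_real (\<Sum>j\<in>F. cmod (f j))" and j: "j \<in> F"
  shows "f j = w * complex_of_real (cmod (f j))"
proof -
  define g where "g j = cnj w * f j" for j
  have ww: "w * cnj w = 1" using w by (simp add: complex_norm_square[symmetric])
  have fg: "f j = w * g j" for j using ww by (simp add: g_def mult.assoc[symmetric])
  have cg: "cmod (g j) = cmod (f j)" for j using w by (simp add: g_def norm_mult)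
  have "(\<Sum>j\<in>F. g j) = cnj w * (\<Sum>j\<in>F. f j)" by (simp add: g_def sum_distrib_left)
  also have "\<dots> = complex_of_real (\<Sum>j\<in>F. cmod (f j))" using ww by (simp add: eq mult.assoc[symmetric] mult.commute)
  finally have "Re (\<Sum>j\<in>F. g j) = (\<Sum>j\<in>F. cmod (f j))" by simp
  then have "(\<Sum>j\<in>F. cmod (g j) - Re (g j)) = 0" by (simp add: sum_subtractf cg)
  moreover have "\<And>j. 0 \<le> cmod (g j) - Re (g j)" using complex_Re_le_cmod by simp
  ultimately have re: "Re (g j) = cmod (g j)" using fin j by (simp add: sum_nonneg_eq_0_iff)
  then have "(cmod (g j))\<^sup>2 = (cmod (g j))\<^sup>2 + (Im (g j))\<^sup>2" using cmod_power2[of "g j"] by simp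
  with re have "g j = complex_of_real (cmod (g j))" by (simp add: complex_eq_iff)
  then show ?thesis using fg[of j] cg[of j] by simp
qed

text \<open>A nonzero off-diagonal \<open>c i j\<close> must have phase -y_i / y_j, times
  \<open>z\<close> below the diagonal; zero entries are unconstrained. For \<open>c\<close> with
  unit diagonal this makes all off-diagonal terms in a row of the pencil point opposite to the
  diagonal one, for vectors with phases \<open>y\<close>.\<close>

definition phase_aligned :: "(nat \<Rightarrow> nat \<Rightarrow> complex) \<Rightarrow> nat set \<Rightarrow> complex \<Rightarrow> (nat \<Rightarrow> complex) \<Rightarrow> bool" where
  "phase_aligned c S z y \<longleftrightarrow> cmod z = 1 \<and> (\<forall>i\<in>S. cmod (y i) = 1) \<and>
     (\<forall>i\<in>S. \<forall>j\<in>S. i \<noteq> j \<longrightarrow>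
        c i j * y j = - (complex_of_real (cmod (c i j)) * y i * (if j < i then z else 1)))"

text \<open>Two off-diagonal entries meet two free phases: the upper entry fixes the relative phase
  \<open>v\<close>, the lower one then fixes \<open>z\<close>. This is why the condition on 2 x 2
  submatrices mentions no ray pattern. A zero entry leaves its phase free, set to 1.\<close>

lemma phase_aligned_card_2:
  assumes "card S = 2"
  shows "\<exists>z y. phase_aligned c S z y"
proof -
  obtain p q where S: "S = {p, q}" "p < q"
    using assms by (auto simp: card_2_iff) (metis insert_commute linorder_neqE_nat)
  define v where "v = (if c p q = 0 then 1 else - complex_of_real (cmod (c p q)) / c p q)"
  define z where "z = (if c q p = 0 then 1 else - c q p / (complex_of_real (cmod (c q p)) * v))"
  have v: "cmod v = 1" "c p q * v = - complex_of_real (cmod (c p q))"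
    by (auto simp: v_def norm_divide)
  have "v \<noteq> 0" using v(1) by auto
  have z: "cmod z = 1" "c q p = - (complex_of_real (cmod (c q p)) * v * z)"
    using v(1) \<open>v \<noteq> 0\<close> by (auto simp: z_def norm_divide norm_mult)
  have "phase_aligned c S z (\<lambda>i. if i = p then 1 else v)"
    using S(2) v z unfolding phase_aligned_def S(1) by auto
  then show ?thesis by blast
qed

text \<open>This is the form in which the H-matrix hypothesis enters both directions of the spectral
  argument.\<close>

lemma H_matrix_nonneg_excess:
  fixes A :: "complex mat"
  defines "w \<equiv> \<lambda>i j. cmod (A $$ (i, j))"
  assumes A: "A \<in> H_matrices n" and S: "S \<subseteq> {..<n}" and irr: "irred_on w S"
    and u: "\<And>i. i \<in> S \<Longrightarrow> 0 \<le> u i" "\<And>i. i \<in> S \<Longrightarrow> 0 \<le> excess w S u i"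
    and nz: "\<exists>i\<in>S. u i \<noteq> 0" and i: "i \<in> S"
  shows "excess w S u i = 0" "0 < u i"
proof -
  have fin: "finite S" using S finite_subset by blast
  have ne: "S \<noteq> {}" using i by blast
  have strict: False if "\<And>i. i \<in> S \<Longrightarrow> 0 \<le> v i" "\<And>i. i \<in> S \<Longrightarrow> 0 < excess w S v i" for v
    by (rule H_matrix_no_strict_excess[OF A S ne]) (fact that[unfolded w_def])+
  have w: "0 \<le> w i j" for i j by (simp add: w_def)
  show "excess w S u i = 0" "0 < u i"
    by (rule irreducible_nonneg_excess[OF fin irr w _ u nz i], rule strict, assumption+)+
qed

context bgs
begin

abbreviation "W \<equiv> \<lambda>i j. cmod (A $$ (i, j))"

text \<open>The obstruction of both conditions of the theorem, stated for index sets of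
  \<open>A\<close>. Equipotence is insensitive to scaling rows and uses the moduli of
  \<open>A\<close> directly; the phases are compared after division by the diagonal.\<close>

definition critical :: "nat set \<Rightarrow> bool" where
  "critical S \<longleftrightarrow> irred_on W S \<and> (\<exists>\<alpha>. \<forall>i\<in>S. 0 < \<alpha> i \<and> excess W S \<alpha> i = 0) \<and>
     (\<exists>z y. phase_aligned (\<lambda>i j. A $$ (i, j) / A $$ (i, i)) S z y)"

lemma irred_on_pencil:
  assumes "z \<noteq> 0" shows "irred_on (bgs_pencil A z) S \<longleftrightarrow> irred_on W S"
  by (rule irred_on_cong) (use assms in \<open>auto simp: bgs_pencil_def\<close>)

text \<open>\<open>S\<close> is an irreducible singular block of the pencil. The moduli of its null
  vector serve as the weights, its phases as \<open>y\<close>, and the eigenvalue itself as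
  \<open>z\<close>.\<close>

lemma critical_exists:
  assumes HA: "A \<in> H_matrices n" and ev: "eigenvalue H z" and z: "1 \<le> cmod z"
  obtains S where "S \<subseteq> {..<n}" "2 \<le> card S" "critical S"
proof -
  have z0: "z \<noteq> 0" using z by auto
  have "singular_on (bgs_pencil A z) {..<n}" using ev by (simp add: eigenvalue_iff)
  then obtain S where S: "S \<subseteq> {..<n}" "singular_on (bgs_pencil A z) S" "irred_on (bgs_pencil A z) S"
    by (rule singular_on_irreducible_subset[OF finite_lessThan])
  from S(2) obtain x where x: "\<exists>i\<in>S. x i \<noteq> 0" "\<And>i. i \<in> S \<Longrightarrow> (\<Sum>j\<in>S. bgs_pencil A z i j * x j) = 0"
    unfolding singular_on_def by blast
  have fin: "finite S" using S(1) finite_subset by blast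
  have irr: "irred_on W S" using S(3) irred_on_pencil[OF z0] by simp
  define u where "u i = cmod (x i)" for i
  have sum_eq: "(\<Sum>j\<in>S - {i}. - (bgs_pencil A z i j * x j)) = z * A $$ (i, i) * x i" if "i \<in> S" for i
    using x(2)[OF that] sum.remove[OF fin that, of "\<lambda>j. bgs_pencil A z i j * x j"]
    by (simp add: bgs_pencil_def sum_negf add_eq_0_iff)
  \<comment> \<open>Entries below the diagonal lack the factor \<open>z\<close>; here |z| >= 1 is
    what makes the bound hold for them.\<close>
  have p_le: "cmod (bgs_pencil A z i j) \<le> cmod z * W i j" for i j
    using mult_right_mono[OF z, of "W i j"] by (simp add: bgs_pencil_def norm_mult)
  have le1: "cmod z * (W i i * u i) \<le> (\<Sum>j\<in>S - {i}. cmod (bgs_pencil A z i j) * u j)" if "i \<in> S" for i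
  proof -
    have "cmod z * (W i i * u i) = cmod (\<Sum>j\<in>S - {i}. - (bgs_pencil A z i j * x j))"
      by (simp add: sum_eq[OF that] u_def norm_mult mult.assoc)
    also have "\<dots> \<le> (\<Sum>j\<in>S - {i}. cmod (- (bgs_pencil A z i j * x j)))" by (rule norm_sum)
    finally show ?thesis by (simp add: u_def norm_mult)
  qed
  have le2: "(\<Sum>j\<in>S - {i}. cmod (bgs_pencil A z i j) * u j) \<le> cmod z * (\<Sum>j\<in>S - {i}. W i j * u j)" for i
    unfolding sum_distrib_left mult.assoc[symmetric]
    by (intro sum_mono mult_right_mono p_le) (simp add: u_def)
  have nonneg: "0 \<le> excess W S u i" if "i \<in> S" for i
  proof -
    have "cmod z * (W i i * u i) \<le> cmod z * (\<Sum>j\<in>S - {i}. W i j * u j)"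
      using le1[OF that] le2[of i] by linarith
    then have "W i i * u i \<le> (\<Sum>j\<in>S - {i}. W i j * u j)"
      by (rule mult_left_le_imp_le) (use z in linarith)
    then show ?thesis by (simp add: excess_def)
  qed
  have "S \<noteq> {}" using x(1) by blast
  have u0: "\<exists>i\<in>S. u i \<noteq> 0" using x(1) by (simp add: u_def)
  have u_nn: "0 \<le> u i" for i by (simp add: u_def)
  have tight: "excess W S u i = 0" "0 < u i" if "i \<in> S" for i
    using H_matrix_nonneg_excess[OF HA S(1) irr u_nn nonneg u0 that] by blast+
  have tight': "W i i * u i = (\<Sum>j\<in>S - {i}. W i j * u j)" if "i \<in> S" for i
    using tight(1)[OF that] by (simp add: excess_def)
  \<comment> \<open>On a singleton the tight row would read |a_ii| u_i = 0.\<close>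
  have card: "2 \<le> card S"
  proof (rule ccontr)
    assume "\<not> 2 \<le> card S"
    with \<open>S \<noteq> {}\<close> fin have "card S = 1" by (metis One_nat_def card_0_eq less_2_cases not_le)
    then obtain i where "S = {i}" by (auto simp: card_1_singleton_iff)
    with tight'[of i] tight(2)[of i] diag[of i] S(1) show False by auto
  qed
  \<comment> \<open>By irreducibility some row has a nonzero entry in the column of the least index
    \<open>m\<close>. That entry lies below the diagonal and is not scaled by \<open>z\<close>, so
    |z| > 1 would make the estimate of this row strict, against tightness.\<close>
  have cz: "cmod z = 1"
  proof (rule ccontr)
    assume "cmod z \<noteq> 1"
    with z have gt: "1 < cmod z" by simp
    define m where "m = Min S"
    have m: "m \<in> S" "\<And>i. i \<in> S \<Longrightarrow> m \<le> i" using fin \<open>S \<noteq> {}\<close> by (auto simp: m_def)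
    have "{m} \<noteq> {}" "{m} \<subset> S" using m(1) card by auto
    then obtain i j where ij: "i \<in> S - {m}" "j \<in> {m}" "W i j \<noteq> 0" by (rule irred_onD[OF irr])
    then have mi: "m < i" "i \<in> S" "W i m \<noteq> 0" using m(2)[of i] by auto
    have "(\<Sum>j\<in>S - {i}. cmod (bgs_pencil A z i j) * u j) < (\<Sum>j\<in>S - {i}. cmod z * W i j * u j)"
    proof (rule sum_strict_mono_ex1)
      show "\<forall>j\<in>S - {i}. cmod (bgs_pencil A z i j) * u j \<le> cmod z * W i j * u j"
        using p_le by (auto simp: u_def intro!: mult_right_mono)
      show "\<exists>j\<in>S - {i}. cmod (bgs_pencil A z i j) * u j < cmod z * W i j * u j"
        using mi m(1) gt tight(2)[OF m(1)] by (intro bexI[of _ m]) (auto simp: bgs_pencil_def)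
    qed (use fin in simp)
    with le1[OF mi(2)] tight'[OF mi(2)] show False by (simp add: sum_distrib_left mult.assoc)
  qed
  define y where "y i = x i / complex_of_real (u i)" for i
  have xy: "x i = complex_of_real (u i) * y i" "cmod (y i) = 1" if "i \<in> S" for i
    using tight(2)[OF that] by (auto simp: y_def u_def norm_divide)
  have "phase_aligned (\<lambda>i j. A $$ (i, j) / A $$ (i, i)) S z y"
    unfolding phase_aligned_def
  proof (intro conjI ballI impI)
    fix i j assume ij: "i \<in> S" "j \<in> S" "i \<noteq> j"
    have aii: "A $$ (i, i) \<noteq> 0" using diag S(1) ij(1) by auto
    \<comment> \<open>The phase of z a_ii x_i, the sum of the negated off-diagonal terms; by
      equality in the triangle inequality each nonzero term has this phase.\<close>
    define w where "w = z * (A $$ (i, i) / complex_of_real (W i i)) * y i"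
    define f where "f j = - (bgs_pencil A z i j * x j)" for j
    have cw: "cmod w = 1" using cz xy(2)[OF ij(1)] aii by (simp add: w_def norm_mult norm_divide)
    have cf: "cmod (f j) = W i j * u j" for j
      using cz by (simp add: f_def u_def norm_mult bgs_pencil_def)
    have "(\<Sum>j\<in>S - {i}. f j) = w * complex_of_real (\<Sum>j\<in>S - {i}. cmod (f j))"
      unfolding f_def[abs_def] sum_eq[OF ij(1)] cf[unfolded f_def] tight'[OF ij(1), symmetric]
      using aii by (subst xy(1)[OF ij(1)]) (simp add: w_def)
    then have "f j = w * complex_of_real (cmod (f j))"
      by (rule norm_sum_eq_imp_aligned[rotated 2]) (use fin ij cw in auto)
    then have "f j = w * complex_of_real (W i j * u j)" by (simp only: cf)
    then have "- (bgs_pencil A z i j * (complex_of_real (u j) * y j)) = w * complex_of_real (W i j * u j)"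
      by (simp only: f_def xy(1)[OF ij(2)])
    then have "bgs_pencil A z i j * (complex_of_real (u j) * y j) = - (w * complex_of_real (W i j * u j))"
      by (metis minus_minus)
    then have "complex_of_real (u j) * (bgs_pencil A z i j * y j) = complex_of_real (u j) * - (w * complex_of_real (W i j))"
      by (simp only: of_real_mult mult_ac mult_minus_right)
    then have "bgs_pencil A z i j * y j = - (w * complex_of_real (W i j))"
      using tight(2)[OF ij(2)] by (metis mult_left_cancel of_real_eq_0_iff less_irrefl)
    then have py: "bgs_pencil A z i j * y j = - (z * (A $$ (i, i) / complex_of_real (W i i) * y i * complex_of_real (W i j)))"
      by (simp add: w_def mult_ac)
    \<comment> \<open>Above the diagonal the pencil carries the factor \<open>z\<close> on both
      sides and it cancels; below the diagonal it remains on the right.\<close>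
    have "A $$ (i, j) * y j
        = - (A $$ (i, i) / complex_of_real (W i i) * y i * complex_of_real (W i j) * (if j < i then z else 1))"
    proof (cases "j < i")
      case True
      then show ?thesis using py by (simp add: bgs_pencil_def mult_ac)
    next
      case False
      then have "z * (A $$ (i, j) * y j) = z * - (A $$ (i, i) / complex_of_real (W i i) * y i * complex_of_real (W i j))"
        using py by (simp add: bgs_pencil_def mult_ac)
      then have "A $$ (i, j) * y j = - (A $$ (i, i) / complex_of_real (W i i) * y i * complex_of_real (W i j))"
        using z0 by (metis mult_left_cancel)
      with False show ?thesis by simp
    qed
    then have "A $$ (i, j) * y j / A $$ (i, i)
        = - (A $$ (i, i) / complex_of_real (W i i) * y i * complex_of_real (W i j) * (if j < i then z else 1)) / A $$ (i, i)"
      by simp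
    then show "A $$ (i, j) / A $$ (i, i) * y j
        = - (complex_of_real (cmod (A $$ (i, j) / A $$ (i, i))) * y i * (if j < i then z else 1))"
      using aii by (simp add: norm_divide mult_ac)
  qed (use cz xy(2) in auto)
  then have "critical S" unfolding critical_def using irr tight by blast
  with S(1) card that show thesis by blast
qed

text \<open>Equipotence supplies the moduli and alignment the phases of a null vector of the pencil
  on \<open>S\<close>. Maximality of \<open>S\<close> among irreducible sets then carries
  singularity to the whole index range.\<close>

lemma critical_imp_eigenvalue:
  assumes HA: "A \<in> H_matrices n" and S: "S \<subseteq> {..<n}" "S \<noteq> {}" and crit: "critical S"
  obtains z where "cmod z = 1" "eigenvalue H z"
proof -
  from crit obtain \<alpha> z y where irr: "irred_on W S"
    and \<alpha>: "\<And>i. i \<in> S \<Longrightarrow> 0 < \<alpha> i" "\<And>i. i \<in> S \<Longrightarrow> excess W S \<alpha> i = 0"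
    and al: "phase_aligned (\<lambda>i j. A $$ (i, j) / A $$ (i, i)) S z y"
    unfolding critical_def by blast
  have fin: "finite S" using S(1) finite_subset by blast
  have cz: "cmod z = 1" using al by (simp add: phase_aligned_def)
  then have z0: "z \<noteq> 0" by auto
  have y0: "y i \<noteq> 0" if "i \<in> S" for i using al that by (auto simp: phase_aligned_def)
  have entry: "bgs_pencil A z i j * y j = - (z * A $$ (i, i) * y i / complex_of_real (W i i) * complex_of_real (W i j))"
    if "i \<in> S" "j \<in> S - {i}" for i j
  proof -
    have aii: "A $$ (i, i) \<noteq> 0" using diag S(1) that by auto
    have "A $$ (i, j) / A $$ (i, i) * y j
        = - (complex_of_real (cmod (A $$ (i, j) / A $$ (i, i))) * y i * (if j < i then z else 1))"
      using al that by (auto simp: phase_aligned_def)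
    then have "A $$ (i, j) * y j
        = - (A $$ (i, i) * complex_of_real (W i j) / complex_of_real (W i i) * y i * (if j < i then z else 1))"
      using aii by (simp add: norm_divide field_simps)
    then show ?thesis by (simp add: bgs_pencil_def field_simps)
  qed
  have "singular_on (bgs_pencil A z) S"
    unfolding singular_on_def
  proof (intro exI[of _ "\<lambda>i. complex_of_real (\<alpha> i) * y i"] conjI ballI)
    show "\<exists>i\<in>S. complex_of_real (\<alpha> i) * y i \<noteq> 0" using S(2) \<alpha>(1) y0 by fastforce
    fix i assume i: "i \<in> S"
    have aii: "A $$ (i, i) \<noteq> 0" using diag S(1) i by auto
    \<comment> \<open>Every off-diagonal term is -q times a nonnegative real; by zero excess these
      reals sum to |a_ii| \<alpha>_i, so the terms cancel the diagonal one.\<close>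
    define q where "q = z * A $$ (i, i) * y i / complex_of_real (W i i)"
    have "(\<Sum>j\<in>S - {i}. bgs_pencil A z i j * (complex_of_real (\<alpha> j) * y j))
        = (\<Sum>j\<in>S - {i}. - q * complex_of_real (W i j * \<alpha> j))"
    proof (intro sum.cong refl)
      fix j assume j: "j \<in> S - {i}"
      have "bgs_pencil A z i j * (complex_of_real (\<alpha> j) * y j) = complex_of_real (\<alpha> j) * (bgs_pencil A z i j * y j)"
        by (simp only: mult.left_commute)
      also have "\<dots> = complex_of_real (\<alpha> j) * - (q * complex_of_real (W i j))"
        by (simp only: entry[OF i j] q_def)
      finally show "bgs_pencil A z i j * (complex_of_real (\<alpha> j) * y j) = - q * complex_of_real (W i j * \<alpha> j)"
        by simp
    qed
    also have "\<dots> = - q * complex_of_real (\<Sum>j\<in>S - {i}. W i j * \<alpha> j)"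
      by (simp add: sum_distrib_left)
    also have "(\<Sum>j\<in>S - {i}. W i j * \<alpha> j) = W i i * \<alpha> i" using \<alpha>(2)[OF i] by (simp add: excess_def)
    also have "- q * complex_of_real (W i i * \<alpha> i) = - (z * A $$ (i, i) * (complex_of_real (\<alpha> i) * y i))"
      using aii by (simp add: q_def)
    finally show "(\<Sum>j\<in>S. bgs_pencil A z i j * (complex_of_real (\<alpha> j) * y j)) = 0"
      using sum.remove[OF fin i, of "\<lambda>j. bgs_pencil A z i j * (complex_of_real (\<alpha> j) * y j)"]
      by (simp add: bgs_pencil_def)
  qed
  moreover have "irred_on (bgs_pencil A z) S" using irr irred_on_pencil[OF z0] by simp
  \<comment> \<open>On an irreducible \<open>T\<close> larger than \<open>S\<close>, the weights
    extended by zero still have nonnegative excess and would have to be positive everywhere on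
    \<open>T\<close>, yet they vanish on \<open>T - S\<close>.\<close>
  moreover have "\<not> irred_on (bgs_pencil A z) T" if T: "S \<subset> T" "T \<subseteq> {..<n}" for T
  proof
    assume "irred_on (bgs_pencil A z) T"
    then have irrT: "irred_on W T" using irred_on_pencil[OF z0] by simp
    have finT: "finite T" using T(2) finite_subset by blast
    define u where "u i = (if i \<in> S then \<alpha> i else 0)" for i
    have u: "0 \<le> u i" for i using \<alpha>(1) by (simp add: u_def less_imp_le)
    have ex: "0 \<le> excess W T u i" if "i \<in> T" for i
    proof (cases "i \<in> S")
      case True
      have "(\<Sum>j\<in>T - {i}. W i j * u j) = (\<Sum>j\<in>S - {i}. W i j * \<alpha> j)"
        using T(1) finT by (intro sum.mono_neutral_cong_right) (auto simp: u_def)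
      then show ?thesis using \<alpha>(2)[OF True] True by (simp add: excess_def u_def)
    next
      case False
      then show ?thesis using u by (simp add: excess_def u_def[of i] sum_nonneg)
    qed
    have nz: "\<exists>i\<in>T. u i \<noteq> 0" using S(2) T(1) \<alpha>(1) by (force simp: u_def)
    obtain t where t: "t \<in> T" "t \<notin> S" using T(1) by blast
    have "0 < u t" by (rule H_matrix_nonneg_excess(2)[OF HA T(2) irrT u ex nz t(1)])
    with t(2) show False by (simp add: u_def)
  qed
  ultimately have "singular_on (bgs_pencil A z) {..<n}"
    using S(1) by (intro singular_on_maximal_irreducible[of "{..<n}" _ S]) auto
  with cz that show thesis by (simp add: eigenvalue_iff)
qed

lemma spectral_radius_less_1_iff_no_critical:
  assumes "A \<in> H_matrices n"
  shows "spectral_radius H < 1 \<longleftrightarrow> \<not> (\<exists>S\<subseteq>{..<n}. 2 \<le> card S \<and> critical S)"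
proof
  assume r: "spectral_radius H < 1"
  show "\<not> (\<exists>S\<subseteq>{..<n}. 2 \<le> card S \<and> critical S)"
  proof
    assume "\<exists>S\<subseteq>{..<n}. 2 \<le> card S \<and> critical S"
    then obtain S where S: "S \<subseteq> {..<n}" "2 \<le> card S" "critical S" by blast
    from S(2) have "S \<noteq> {}" by auto
    from critical_imp_eigenvalue[OF assms S(1) this S(3)] obtain z where "cmod z = 1" "eigenvalue H z" .
    with r show False unfolding spectral_radius_less_1_iff by force
  qed
next
  assume none: "\<not> (\<exists>S\<subseteq>{..<n}. 2 \<le> card S \<and> critical S)"
  then show "spectral_radius H < 1"
    unfolding spectral_radius_less_1_iff
  proof (intro allI impI)
    fix z assume ev: "eigenvalue H z"
    show "cmod z < 1"
    proof (rule ccontr)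
      assume "\<not> cmod z < 1"
      then have "1 \<le> cmod z" by simp
      from critical_exists[OF assms ev this] obtain S where "S \<subseteq> {..<n}" "2 \<le> card S" "critical S" .
      with none show False by blast
    qed
  qed
qed

end

section \<open>Principal submatrices and ray patterns\<close>

text \<open>The enumeration must preserve order, because the factor \<open>z\<close> depends on
  which of two indices is smaller.\<close>

lemma phase_aligned_reindex:
  assumes e: "bij_betw e {..<k} I" and mono: "\<And>r s. r < k \<Longrightarrow> s < k \<Longrightarrow> e r < e s \<longleftrightarrow> r < s"
  shows "(\<exists>z y. phase_aligned (\<lambda>r s. c (e r) (e s)) {..<k} z y) \<longleftrightarrow> (\<exists>z y. phase_aligned c I z y)"
proof
  have I: "I = e ` {..<k}" using e by (simp add: bij_betw_def)
  have inj: "e r = e s \<longleftrightarrow> r = s" if "r < k" "s < k" for r s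
    using e that by (auto simp: bij_betw_def inj_on_def)
  {
    assume "\<exists>z y. phase_aligned c I z y"
    then obtain z y where "phase_aligned c I z y" by blast
    then have "phase_aligned (\<lambda>r s. c (e r) (e s)) {..<k} z (\<lambda>r. y (e r))"
      unfolding phase_aligned_def I using inj mono by auto
    then show "\<exists>z y. phase_aligned (\<lambda>r s. c (e r) (e s)) {..<k} z y" by blast
  next
    assume "\<exists>z y. phase_aligned (\<lambda>r s. c (e r) (e s)) {..<k} z y"
    then obtain z y where zy: "phase_aligned (\<lambda>r s. c (e r) (e s)) {..<k} z y" by blast
    define y' where "y' i = y (inv_into {..<k} e i)" for i
    have y': "y' (e r) = y r" if "r < k" for r
      using e that by (simp add: y'_def bij_betw_def inv_into_f_f)
    have "phase_aligned c I z y'"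
      using zy unfolding phase_aligned_def I using inj mono y' by auto
    then show "\<exists>z y. phase_aligned c I z y" by blast
  }
qed

lemma irred_on_reindex:
  assumes "bij_betw e K I"
  shows "irred_on (\<lambda>r s. a (e r) (e s)) K \<longleftrightarrow> irred_on a I"
proof
  have I: "I = e ` K" and inj: "inj_on e K" using assms by (auto simp: bij_betw_def)
  {
    assume irr: "irred_on a I"
    show "irred_on (\<lambda>r s. a (e r) (e s)) K"
      unfolding irred_on_def
    proof (intro allI impI)
      fix Q assume Q: "Q \<noteq> {} \<and> Q \<subset> K"
      then have "e ` Q \<noteq> {}" "e ` Q \<subset> I" using inj_on_image_eq_iff[OF inj, of Q K] by (auto simp: I)
      then obtain i j where ij: "i \<in> I - e ` Q" "j \<in> e ` Q" "a i j \<noteq> 0" by (rule irred_onD[OF irr])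
      then show "\<exists>r\<in>K - Q. \<exists>s\<in>Q. a (e r) (e s) \<noteq> 0" by (auto simp: I)
    qed
  next
    assume irr: "irred_on (\<lambda>r s. a (e r) (e s)) K"
    show "irred_on a I"
      unfolding irred_on_def
    proof (intro allI impI)
      fix Q assume Q: "Q \<noteq> {} \<and> Q \<subset> I"
      define Q' where "Q' = {r\<in>K. e r \<in> Q}"
      have "Q' \<noteq> {}" "Q' \<subset> K" using Q by (auto simp: Q'_def I)
      then obtain r s where "r \<in> K - Q'" "s \<in> Q'" "a (e r) (e s) \<noteq> 0" by (rule irred_onD[OF irr])
      then show "\<exists>i\<in>I - Q. \<exists>j\<in>Q. a i j \<noteq> 0" by (auto simp: Q'_def I)
    qed
  }
qed

text \<open>A permutation to block triangular form places a set \<open>Q\<close> on the first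
  \<open>r\<close> positions: from the permutation, \<open>Q\<close> is the image of these
  positions; from \<open>Q\<close>, a permutation is built by listing \<open>Q\<close>
  first.\<close>

lemma irreducible_mat_iff:
  "irreducible_mat k P \<longleftrightarrow> irred_on (\<lambda>r s. P $$ (r, s)) {..<k}"
proof -
  have "reducible_mat k P \<longleftrightarrow> \<not> irred_on (\<lambda>r s. P $$ (r, s)) {..<k}"
  proof
    assume "reducible_mat k P"
    then obtain p r where p: "p permutes {..<k}" and r: "1 \<le> r" "r < k"
      and z: "\<And>i j. r \<le> i \<Longrightarrow> i < k \<Longrightarrow> j < r \<Longrightarrow> P $$ (p i, p j) = 0"
      unfolding reducible_mat_def by blast
    define Q where "Q = p ` {..<r}"
    have im: "p ` {..<k} = {..<k}" using p by (rule permutes_image)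
    have "p r \<notin> Q" using permutes_inj[OF p] by (auto simp: Q_def inj_eq)
    moreover have "p r < k" using im r by blast
    moreover have "Q \<subseteq> p ` {..<k}" unfolding Q_def using r by (intro image_mono) auto
    ultimately have sub: "Q \<subset> {..<k}" using im by auto
    have "p 0 \<in> Q" unfolding Q_def using r by (intro imageI) simp
    then have ne: "Q \<noteq> {}" by blast
    have "P $$ (x, y) = 0" if xy: "x \<in> {..<k} - Q" "y \<in> Q" for x y
    proof -
      have "x \<in> p ` {..<k}" unfolding im using xy(1) by blast
      then obtain i where i: "i < k" "x = p i" by blast
      obtain j where j: "j < r" "y = p j" using xy(2) unfolding Q_def by blast
      have "\<not> i < r" using xy(1) i(2) unfolding Q_def by blast
      with i j z show ?thesis by simp
    qed
    with ne sub show "\<not> irred_on (\<lambda>r s. P $$ (r, s)) {..<k}" unfolding irred_on_def by blast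
  next
    assume "\<not> irred_on (\<lambda>r s. P $$ (r, s)) {..<k}"
    then obtain Q where Q: "Q \<noteq> {}" "Q \<subset> {..<k}" "\<And>i j. i \<in> {..<k} - Q \<Longrightarrow> j \<in> Q \<Longrightarrow> P $$ (i, j) = 0"
      by (rule not_irred_onD) blast
    define r where "r = card Q"
    have finQ: "finite Q" using Q(2) finite_subset by blast
    have r: "1 \<le> r" "r < k"
      using Q finQ psubset_card_mono[of "{..<k}" Q] by (auto simp: r_def card_gt_0_iff Suc_le_eq)
    obtain f where f: "bij_betw f {..<r} Q"
      using finite_same_card_bij[of "{..<r}" Q] finQ by (auto simp: r_def)
    have "card {r..<k} = card ({..<k} - Q)"
      using Q(2) finQ by (subst card_Diff_subset) (auto simp: r_def)
    then obtain g where g: "bij_betw g {r..<k} ({..<k} - Q)"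
      using finite_same_card_bij[of "{r..<k}" "{..<k} - Q"] by auto
    \<comment> \<open>\<open>f\<close> enumerates \<open>Q\<close> and \<open>g\<close> its
      complement; outside the index range \<open>p\<close> must be the identity to be a permutation
      of it.\<close>
    define p where "p i = (if i < r then f i else if i < k then g i else i)" for i
    have pf: "bij_betw p {..<r} Q" using f by (subst bij_betw_cong[of _ _ f]) (auto simp: p_def)
    have pg: "bij_betw p {r..<k} ({..<k} - Q)" using g by (subst bij_betw_cong[of _ _ g]) (auto simp: p_def)
    have "bij_betw p ({..<r} \<union> {r..<k}) (Q \<union> ({..<k} - Q))"
      by (rule bij_betw_combine[OF pf pg]) auto
    moreover have "{..<r} \<union> {r..<k} = {..<k}" "Q \<union> ({..<k} - Q) = {..<k}" using r Q(2) by auto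
    ultimately have "bij_betw p {..<k} {..<k}" by simp
    then have "p permutes {..<k}" by (rule bij_imp_permutes) (use r in \<open>auto simp: p_def\<close>)
    moreover have "P $$ (p i, p j) = 0" if "r \<le> i" "i < k" "j < r" for i j
      using Q(3)[of "p i" "p j"] bij_betwE[OF pf] bij_betwE[OF pg] that by simp
    ultimately show "reducible_mat k P" unfolding reducible_mat_def using r by blast
  qed
  then show ?thesis by (simp add: irreducible_mat_def)
qed

lemma GDE_iff:
  "P \<in> GDE k \<longleftrightarrow> P \<in> carrier_mat k k \<and>
     (\<exists>\<alpha>. \<forall>i\<in>{..<k}. 0 < \<alpha> i \<and> excess (\<lambda>i j. cmod (P $$ (i, j))) {..<k} \<alpha> i = 0)"
proof -
  have "\<alpha> i * cmod (P $$ (i, i)) = (\<Sum>j\<in>{..<k} - {i}. \<alpha> j * cmod (P $$ (i, j)))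
      \<longleftrightarrow> excess (\<lambda>i j. cmod (P $$ (i, j))) {..<k} \<alpha> i = 0" for \<alpha> i
    by (auto simp: excess_def mult.commute)
  then show ?thesis unfolding GDE_def by auto
qed

lemma excess_reindex:
  assumes "inj_on e K" "r \<in> K"
  shows "excess (\<lambda>r s. w (e r) (e s)) K (\<lambda>r. u (e r)) r = excess w (e ` K) u (e r)"
proof -
  have "e ` K - {e r} = e ` (K - {r})" using assms by (auto simp: inj_on_def)
  then have "(\<Sum>j\<in>e ` K - {e r}. w (e r) j * u j) = (\<Sum>s\<in>K - {r}. w (e r) (e s) * u (e s))"
    using assms by (simp add: sum.reindex inj_on_diff)
  then show ?thesis by (simp add: excess_def)
qed

lemma equipotent_reindex:
  assumes e: "bij_betw e K I"
  shows "(\<exists>\<alpha>. \<forall>r\<in>K. 0 < \<alpha> r \<and> excess (\<lambda>r s. w (e r) (e s)) K \<alpha> r = 0) \<longleftrightarrow>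
    (\<exists>\<alpha>. \<forall>i\<in>I. 0 < \<alpha> i \<and> excess w I \<alpha> i = 0)"
proof
  have I: "I = e ` K" and inj: "inj_on e K" using e by (auto simp: bij_betw_def)
  {
    assume "\<exists>\<alpha>. \<forall>i\<in>I. 0 < \<alpha> i \<and> excess w I \<alpha> i = 0"
    then obtain \<alpha> where "\<forall>i\<in>I. 0 < \<alpha> i \<and> excess w I \<alpha> i = 0" by blast
    then have "\<forall>r\<in>K. 0 < \<alpha> (e r) \<and> excess (\<lambda>r s. w (e r) (e s)) K (\<lambda>r. \<alpha> (e r)) r = 0"
      by (auto simp: I excess_reindex[OF inj])
    then show "\<exists>\<alpha>. \<forall>r\<in>K. 0 < \<alpha> r \<and> excess (\<lambda>r s. w (e r) (e s)) K \<alpha> r = 0"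
      by (rule exI[of _ "\<lambda>r. \<alpha> (e r)"])
  next
    assume "\<exists>\<alpha>. \<forall>r\<in>K. 0 < \<alpha> r \<and> excess (\<lambda>r s. w (e r) (e s)) K \<alpha> r = 0"
    then obtain \<alpha> where \<alpha>: "\<forall>r\<in>K. 0 < \<alpha> r \<and> excess (\<lambda>r s. w (e r) (e s)) K \<alpha> r = 0" by blast
    define \<beta> where "\<beta> i = \<alpha> (inv_into K e i)" for i
    have \<beta>: "\<beta> (e r) = \<alpha> r" if "r \<in> K" for r using inj that by (simp add: \<beta>_def)
    have "excess (\<lambda>r s. w (e r) (e s)) K (\<lambda>r. \<beta> (e r)) r = excess (\<lambda>r s. w (e r) (e s)) K \<alpha> r" if "r \<in> K" for r
      unfolding excess_def using \<beta> that by (intro arg_cong2[of _ _ _ _ "(-)"] sum.cong) auto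
    then have "\<forall>i\<in>I. 0 < \<beta> i \<and> excess w I \<beta> i = 0"
      using \<alpha> by (auto simp: I \<beta> excess_reindex[OF inj, symmetric])
    then show "\<exists>\<alpha>. \<forall>i\<in>I. 0 < \<alpha> i \<and> excess w I \<alpha> i = 0" by blast
  }
qed

text \<open>The ray pattern congruences express that the phases form, up to sign and the factor
  \<open>cis \<phi>\<close> below the diagonal, quotients of unit numbers \<open>y r\<close> and
  \<open>y s\<close>. From a pattern, \<open>y\<close> is read off the first column; from
  \<open>y\<close>, the angles are differences of arguments.\<close>

lemma L_class_iff_phase_aligned:
  assumes R: "R \<in> carrier_mat k k" and one: "\<And>r. r < k \<Longrightarrow> R $$ (r, r) = 1" and k: "0 < k"
  shows "(\<exists>\<phi>. R \<in> L_class k \<phi>) \<longleftrightarrow> (\<exists>z y. phase_aligned (\<lambda>r s. R $$ (r, s)) {..<k} z y)"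
proof
  assume "\<exists>\<phi>. R \<in> L_class k \<phi>"
  then obtain \<phi> \<eta> P where P: "ray_pattern k \<phi> P"
    and RP: "\<forall>r<k. \<forall>s<k. R $$ (r, s) = cis \<eta> * complex_of_real (cmod (R $$ (r, s))) * P $$ (r, s)"
    unfolding L_class_def by blast
  from P obtain f where Pf: "P = mat k k (\<lambda>(r, s). cis (f r s))" and
    f1: "\<forall>r<k. \<forall>s<k. r \<noteq> s \<longrightarrow> [f r s + f s r = \<phi>] (rmod 2 * pi)" and
    f2: "\<forall>r<k. \<forall>s<k. \<forall>t<k. (r < s \<and> s < t) \<or> (s < t \<and> t < r) \<or> (t < r \<and> r < s) \<longrightarrow>
        [f r s - f r t = f t s - \<phi> + pi] (rmod 2 * pi)" and
    f3: "\<forall>r<k. \<forall>s<k. \<forall>t<k. (r < t \<and> t < s) \<or> (t < s \<and> s < r) \<or> (s < r \<and> r < t) \<longrightarrow>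
        [f r s - f r t = f t s + pi] (rmod 2 * pi)" and
    f4: "\<forall>r<k. f r r = 0"
    unfolding ray_pattern_def by blast
  have Rf: "R $$ (r, s) = cis \<eta> * complex_of_real (cmod (R $$ (r, s))) * cis (f r s)" if "r < k" "s < k" for r s
    using RP that by (simp add: Pf)
  define F where "F r s = cis (f r s)" for r s
  define Z where "Z = cis \<phi>"
  have nz: "F r s \<noteq> 0" "Z \<noteq> 0" for r s by (simp_all add: F_def Z_def)
  have F1: "F r s * F s r = Z" if "r < k" "s < k" "r \<noteq> s" for r s
    using cis_cong[OF f1[rule_format, OF that]] by (simp add: F_def Z_def cis_mult)
  have F2: "F r s / F r t = - (F t s / Z)"
    if "r < k" "s < k" "t < k" "t < r \<and> r < s" for r s t
  proof -
    have "cis (f r s - f r t) = cis (f t s - \<phi> + pi)" by (rule cis_cong[OF f2[rule_format]]) (use that in auto)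
    also have "\<dots> = cis (f t s - \<phi>) * cis pi" by (simp only: cis_mult)
    finally show ?thesis by (simp add: F_def Z_def cis_divide)
  qed
  have F3: "F r s / F r t = - F t s"
    if "r < k" "s < k" "t < k" "t < s \<and> s < r" for r s t
  proof -
    have "cis (f r s - f r t) = cis (f t s + pi)" by (rule cis_cong[OF f3[rule_format]]) (use that in auto)
    also have "\<dots> = cis (f t s) * cis pi" by (simp only: cis_mult)
    finally show ?thesis by (simp add: F_def cis_divide)
  qed
  \<comment> \<open>The unit diagonal entry, together with the zero diagonal angle, removes the
    common rotation.\<close>
  have "cis \<eta> = 1" using Rf[OF k k] one[OF k] f4 k by simp
  then have RF: "R $$ (r, s) = complex_of_real (cmod (R $$ (r, s))) * F r s" if "r < k" "s < k" for r s
    using Rf[OF that] by (simp add: F_def)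
  \<comment> \<open>With y_0 = 1, the alignment equation of row \<open>r\<close> and column 0 forces
    this value. The remaining entries follow from \<open>F2\<close> above and \<open>F3\<close>
    below the diagonal, both taken at t = 0.\<close>
  define y where "y r = (if r = 0 then 1 else - F r 0 / Z)" for r
  have al: "F i j * y j = - (y i * (if j < i then Z else 1))" if ij: "i < k" "j < k" "i \<noteq> j" for i j
  proof -
    consider "j = 0" "0 < i" | "i = 0" "0 < j" | "0 < i" "i < j" | "0 < j" "j < i"
      using ij(3) by linarith
    then show ?thesis
    proof cases
      case 1
      then show ?thesis using nz by (simp add: y_def)
    next
      case 2
      then show ?thesis using nz F1[OF ij] by (simp add: y_def)
    next
      case 3
      have "F i j / F i 0 = - (F 0 j / Z)" by (rule F2) (use ij 3 k in auto)
      then have "F i j = - (F 0 j / Z) * F i 0" using nz(1) by (simp only: divide_eq_eq) simp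
      then have "F i j * (Z * F j 0) = - (F i 0 * (F 0 j * F j 0))" using nz(2) by simp
      then have "F i j * (Z * F j 0) = - (F i 0 * Z)" using F1[of 0 j] k ij 3 by simp
      then show ?thesis using nz 3 by (simp add: y_def field_simps)
    next
      case 4
      have "F i j / F i 0 = - F 0 j" by (rule F3) (use ij 4 k in auto)
      then have "F i j * F j 0 = - (F i 0 * (F 0 j * F j 0))" using nz by (simp add: field_simps)
      then have "F i j * F j 0 = - (F i 0 * Z)" using F1[of 0 j] k ij 4 by simp
      then show ?thesis using nz 4 by (simp add: y_def field_simps)
    qed
  qed
  have "phase_aligned (\<lambda>r s. R $$ (r, s)) {..<k} Z y"
    unfolding phase_aligned_def
  proof (intro conjI ballI impI)
    show "cmod Z = 1" by (simp add: Z_def)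
    show "cmod (y i) = 1" for i by (simp add: y_def F_def Z_def norm_divide)
    fix i j assume "i \<in> {..<k}" "j \<in> {..<k}" "i \<noteq> j"
    then have ij: "i < k" "j < k" "i \<noteq> j" by auto
    have "R $$ (i, j) * y j = complex_of_real (cmod (R $$ (i, j))) * (F i j * y j)"
      by (subst RF[OF ij(1,2)]) (simp only: mult.assoc)
    then show "R $$ (i, j) * y j = - (complex_of_real (cmod (R $$ (i, j))) * y i * (if j < i then Z else 1))"
      unfolding al[OF ij] by (simp only: mult_minus_right mult.assoc)
  qed
  then show "\<exists>z y. phase_aligned (\<lambda>r s. R $$ (r, s)) {..<k} z y" by blast
next
  assume "\<exists>z y. phase_aligned (\<lambda>r s. R $$ (r, s)) {..<k} z y"
  then obtain z y where zy: "phase_aligned (\<lambda>r s. R $$ (r, s)) {..<k} z y" by blast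
  have cz: "cmod z = 1" and cy: "\<And>i. i < k \<Longrightarrow> cmod (y i) = 1"
    using zy by (simp_all add: phase_aligned_def)
  have al: "R $$ (i, j) * y j = - (complex_of_real (cmod (R $$ (i, j))) * y i * (if j < i then z else 1))"
    if "i < k" "j < k" "i \<noteq> j" for i j
    using zy that unfolding phase_aligned_def by blast
  define \<phi> where "\<phi> = Arg z"
  define \<psi> where "\<psi> i = Arg (y i)" for i
  have z: "z = cis \<phi>" using cz cis_Arg[of z] by (force simp: \<phi>_def sgn_eq)
  have y: "y i = cis (\<psi> i)" if "i < k" for i
    using cy[OF that] cis_Arg[of "y i"] by (force simp: \<psi>_def sgn_eq)
  \<comment> \<open>The summand \<open>pi\<close> encodes the minus sign of the alignment
    equation.\<close>
  define f where "f r s = (if r = s then 0 else \<psi> r - \<psi> s + pi + (if s < r then \<phi> else 0))" for r s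
  have rc: "[a = b] (rmod 2 * pi)" if "b = a + of_int m * (2 * pi)" for a b m
    unfolding rcong_altdef using that by blast
  have "ray_pattern k \<phi> (mat k k (\<lambda>(r, s). cis (f r s)))"
    unfolding ray_pattern_def
  proof (intro exI[of _ f] conjI allI impI)
    \<comment> \<open>In each of the three congruences the sides differ by exactly one full turn,
      made of two summands \<open>pi\<close>.\<close>
    show "[f r s + f s r = \<phi>] (rmod 2 * pi)" if "r \<noteq> s" for r s
      by (rule rc[of _ _ "- 1"]) (use that in \<open>auto simp: f_def\<close>)
    show "[f r s - f r t = f t s - \<phi> + pi] (rmod 2 * pi)"
      if "(r < s \<and> s < t) \<or> (s < t \<and> t < r) \<or> (t < r \<and> r < s)" for r s t
      by (rule rc[of _ _ 1]) (use that in \<open>auto simp: f_def\<close>)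
    show "[f r s - f r t = f t s + pi] (rmod 2 * pi)"
      if "(r < t \<and> t < s) \<or> (t < s \<and> s < r) \<or> (s < r \<and> r < t)" for r s t
      by (rule rc[of _ _ 1]) (use that in \<open>auto simp: f_def\<close>)
  qed (simp_all add: f_def)
  moreover have "R $$ (r, s) = cis 0 * complex_of_real (cmod (R $$ (r, s))) * mat k k (\<lambda>(r, s). cis (f r s)) $$ (r, s)"
    if "r < k" "s < k" for r s
  proof (cases "r = s")
    case True
    then show ?thesis using one that by (simp add: f_def)
  next
    case False
    have "cis (f r s) = - (cis (\<psi> r) / cis (\<psi> s) * (if s < r then cis \<phi> else 1))"
      using False by (simp add: f_def cis_mult[symmetric] cis_divide[symmetric])
    moreover have "R $$ (r, s) = - (complex_of_real (cmod (R $$ (r, s))) * cis (\<psi> r) * (if s < r then cis \<phi> else 1)) / cis (\<psi> s)"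
      using al[OF that False] unfolding z y[OF that(1)] y[OF that(2)] by (rule eq_divide_imp[OF cis_neq_zero])
    ultimately have "R $$ (r, s) = complex_of_real (cmod (R $$ (r, s))) * cis (f r s)"
      by (metis mult.assoc mult_minus_right times_divide_eq_left times_divide_eq_right)
    then show ?thesis using that by simp
  qed
  ultimately have "R \<in> L_class k \<phi>" unfolding L_class_def using R by blast
  then show "\<exists>\<phi>. R \<in> L_class k \<phi>" ..
qed

section \<open>Principal submatrices of \<open>A\<close> and their critical index sets\<close>

context bgs
begin

text \<open>\<open>pick I\<close> is the increasing enumeration of \<open>I\<close>, so it
  transports the order-dependent phase conditions as well as the order-free ones.\<close>

lemma principal_submatrix_facts:
  assumes I: "I \<subseteq> {..<n}" and k: "card I = k"
  shows "principal_submatrix A I \<in> carrier_mat k k"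
    and "\<And>r s. r < k \<Longrightarrow> s < k \<Longrightarrow> principal_submatrix A I $$ (r, s) = A $$ (pick I r, pick I s)"
    and "bij_betw (pick I) {..<k} I"
    and "\<And>r s. r < k \<Longrightarrow> s < k \<Longrightarrow> pick I r < pick I s \<longleftrightarrow> r < s"
proof -
  have fin: "finite I" using I finite_subset by blast
  have eq: "{i. i < dim_row A \<and> i \<in> I} = I" "{i. i < dim_col A \<and> i \<in> I} = I" using I A by auto
  show "principal_submatrix A I \<in> carrier_mat k k"
    by (intro carrier_matI) (simp_all only: dim_submatrix eq k)
  show "principal_submatrix A I $$ (r, s) = A $$ (pick I r, pick I s)" if "r < k" "s < k" for r s
    by (rule submatrix_index) (simp_all only: eq k that)
  have mono: "pick I r < pick I s" if "r < s" "s < k" for r s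
    using pick_mono_le[of s I r] that k by simp
  show iff: "pick I r < pick I s \<longleftrightarrow> r < s" if "r < k" "s < k" for r s
    using mono[of r s] mono[of s r] that by (metis linorder_neqE_nat less_asym less_irrefl)
  have inj: "inj_on (pick I) {..<k}"
    by (rule inj_onI) (metis iff lessThan_iff less_irrefl linorder_neqE_nat)
  have sub: "pick I ` {..<k} \<subseteq> I" using pick_in_set_le[of _ I] k by auto
  have "card (pick I ` {..<k}) = card I" using card_image[OF inj] k by simp
  then have "pick I ` {..<k} = I" by (rule card_subset_eq[OF fin sub])
  with inj show "bij_betw (pick I) {..<k} I" by (simp add: bij_betw_def)
qed

context
  fixes I k
  assumes I: "I \<subseteq> {..<n}" and k: "card I = k"
begin

abbreviation "P \<equiv> principal_submatrix A I"

lemmas sub = principal_submatrix_facts[OF I k]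

lemma pick_less: "r < k \<Longrightarrow> pick I r < n"
  using bij_betwE[OF sub(3)] I by auto

lemma irreducible_principal_submatrix: "irreducible_mat k P \<longleftrightarrow> irred_on W I"
proof -
  have "irred_on (\<lambda>r s. P $$ (r, s)) {..<k} \<longleftrightarrow> irred_on (\<lambda>r s. W (pick I r) (pick I s)) {..<k}"
    by (rule irred_on_cong) (simp add: sub(2))
  also have "\<dots> \<longleftrightarrow> irred_on W I" by (rule irred_on_reindex[OF sub(3)])
  finally show ?thesis by (simp only: irreducible_mat_iff)
qed

lemma GDE_principal_submatrix: "P \<in> GDE k \<longleftrightarrow> (\<exists>\<alpha>. \<forall>i\<in>I. 0 < \<alpha> i \<and> excess W I \<alpha> i = 0)"
proof -
  have "excess (\<lambda>i j. cmod (P $$ (i, j))) {..<k} \<alpha> r = excess (\<lambda>r s. W (pick I r) (pick I s)) {..<k} \<alpha> r"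
    if "r \<in> {..<k}" for \<alpha> r
    unfolding excess_def using that sub(2) by (intro arg_cong2[of _ _ _ _ "(-)"] sum.cong) auto
  then show ?thesis using sub(1) by (simp add: GDE_iff equipotent_reindex[OF sub(3), of W, symmetric])
qed

abbreviation "R \<equiv> mat_inv (diag_part P) * P"

text \<open>The inverse of the diagonal part is never computed: reading the entries of
  \<open>D * R = P\<close> row by row gives the quotients.\<close>

lemma normalized_principal_submatrix:
  "R \<in> carrier_mat k k" "\<And>r s. r < k \<Longrightarrow> s < k \<Longrightarrow> R $$ (r, s) = P $$ (r, s) / P $$ (r, r)"
proof -
  define D where "D = diag_part P"
  have D: "D \<in> carrier_mat k k" and D_index: "\<And>r s. r < k \<Longrightarrow> s < k \<Longrightarrow> D $$ (r, s) = (if r = s then P $$ (r, r) else 0)"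
    using carrier_matD[OF sub(1)] by (auto simp: D_def diag_part_def mat_diag_def)
  have nz: "P $$ (r, r) \<noteq> 0" if "r < k" for r using that sub(2) diag pick_less by simp
  have "det D = prod_list (diag_mat D)"
    by (rule det_upper_triangular[OF _ D]) (use D D_index in auto)
  moreover have "0 \<notin> set (diag_mat D)" using D D_index nz by (auto simp: diag_mat_def)
  ultimately have "det D \<noteq> 0" by (simp add: prod_list_zero_iff)
  note inv = mat_inv[OF D this]
  show R: "R \<in> carrier_mat k k" using inv(1) sub(1) by (simp add: D_def)
  have "D * R = (D * mat_inv D) * P"
    unfolding D_def[symmetric] by (rule assoc_mult_mat[symmetric, OF D inv(1) sub(1)])
  then have DR: "D * R = P" using inv(2) sub(1) by simp
  show "R $$ (r, s) = P $$ (r, s) / P $$ (r, r)" if rs: "r < k" "s < k" for r s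
  proof -
    have "(D * R) $$ (r, s) = (\<Sum>t<k. D $$ (r, t) * R $$ (t, s))"
      using carrier_matD[OF D] carrier_matD[OF R] rs
      by (auto simp: scalar_prod_def atLeast0LessThan simp del: index_mult_mat(2,3) intro!: sum.cong)
    also have "\<dots> = (\<Sum>t<k. if t = r then P $$ (r, r) * R $$ (r, s) else 0)"
      using rs by (intro sum.cong) (auto simp: D_index)
    also have "\<dots> = P $$ (r, r) * R $$ (r, s)" using rs by simp
    finally show ?thesis using nz[OF rs(1)] by (simp only: DR) simp
  qed
qed

text \<open>Normalization divides the excess of each row by a positive number, which does not affect
  whether it is zero.\<close>

lemma GDE_normalized: "R \<in> GDE k \<longleftrightarrow> P \<in> GDE k"
proof -
  have nz: "P $$ (r, r) \<noteq> 0" if "r < k" for r using that sub(2) diag pick_less by simp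
  have "excess (\<lambda>i j. cmod (R $$ (i, j))) {..<k} \<alpha> r = excess (\<lambda>i j. cmod (P $$ (i, j))) {..<k} \<alpha> r / cmod (P $$ (r, r))"
    if r: "r < k" for \<alpha> r
  proof -
    have "(\<Sum>j\<in>{..<k} - {r}. cmod (R $$ (r, j)) * \<alpha> j) = (\<Sum>j\<in>{..<k} - {r}. cmod (P $$ (r, j)) * \<alpha> j / cmod (P $$ (r, r)))"
      by (intro sum.cong refl) (use r normalized_principal_submatrix(2) in \<open>simp add: norm_divide\<close>)
    then show ?thesis using r normalized_principal_submatrix(2)[OF r r]
      by (simp add: excess_def norm_divide sum_divide_distrib diff_divide_distrib)
  qed
  then show ?thesis using normalized_principal_submatrix(1) sub(1) nz by (simp add: GDE_iff)
qed

lemma L_class_normalized: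
  assumes "0 < k"
  shows "(\<exists>\<phi>. R \<in> L_class k \<phi>) \<longleftrightarrow> (\<exists>z y. phase_aligned (\<lambda>i j. A $$ (i, j) / A $$ (i, i)) I z y)"
proof -
  have nz: "P $$ (r, r) \<noteq> 0" if "r < k" for r using that sub(2) diag pick_less by simp
  have "(\<exists>\<phi>. R \<in> L_class k \<phi>) \<longleftrightarrow> (\<exists>z y. phase_aligned (\<lambda>r s. R $$ (r, s)) {..<k} z y)"
    by (rule L_class_iff_phase_aligned[OF normalized_principal_submatrix(1) _ assms])
      (simp add: normalized_principal_submatrix(2) nz)
  also have "\<dots> \<longleftrightarrow> (\<exists>z y. phase_aligned (\<lambda>r s. A $$ (pick I r, pick I s) / A $$ (pick I r, pick I r)) {..<k} z y)"
    unfolding phase_aligned_def by (simp add: normalized_principal_submatrix(2) sub(2))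
  also have "\<dots> \<longleftrightarrow> (\<exists>z y. phase_aligned (\<lambda>i j. A $$ (i, j) / A $$ (i, i)) I z y)"
    by (rule phase_aligned_reindex[OF sub(3,4)])
  finally show ?thesis .
qed

lemma critical_iff:
  assumes "0 < k"
  shows "critical I \<longleftrightarrow> irreducible_mat k P \<and> (\<exists>\<phi>. R \<in> L_class k \<phi> \<inter> GDE k)"
  unfolding critical_def irreducible_principal_submatrix
  using GDE_normalized GDE_principal_submatrix L_class_normalized[OF assms] by blast

text \<open>For two indices the phases can always be aligned, so irreducibility and equipotence
  remain.\<close>

lemma critical_iff_2:
  assumes "k = 2"
  shows "critical I \<longleftrightarrow> irreducible_mat 2 P \<and> P \<in> GDE 2"
  unfolding critical_def irreducible_principal_submatrix[unfolded assms] GDE_principal_submatrix[unfolded assms]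
  using phase_aligned_card_2 k assms by blast

end

end

theorem theorem4p25:
  fixes n :: nat and A :: "complex mat" and b :: "complex vec"
  assumes "0 < n"
    and "A \<in> H_matrices n"
    and "\<And>i. i < n \<Longrightarrow> A $$ (i, i) \<noteq> 0"
    and "b \<in> carrier_vec n"
  shows "(spectral_radius (BGS_mat A) < 1 \<longleftrightarrow> BGS_convergent n A b) \<and>
    (spectral_radius (BGS_mat A) < 1 \<longleftrightarrow>
      \<not> (\<exists>I\<subseteq>{..<n}. card I = 2 \<and> irreducible_mat 2 (principal_submatrix A I) \<and>
            principal_submatrix A I \<in> GDE 2) \<and>
      \<not> (\<exists>k I. 3 \<le> k \<and> k \<le> n \<and> I \<subseteq> {..<n} \<and> card I = k \<and>
            irreducible_mat k (principal_submatrix A I) \<and>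
            (\<exists>\<phi>. mat_inv (diag_part (principal_submatrix A I)) * principal_submatrix A I
                   \<in> L_class k \<phi> \<inter> GDE k)))"
proof -
  interpret bgs n A
    using assms by unfold_locales (auto simp: H_matrices_def)
  \<comment> \<open>Critical sets are sorted by size: those with two elements violate the first
    condition, larger ones the second.\<close>
  have "(\<exists>I\<subseteq>{..<n}. 2 \<le> card I \<and> critical I) \<longleftrightarrow>
      (\<exists>I\<subseteq>{..<n}. card I = 2 \<and> irreducible_mat 2 (principal_submatrix A I) \<and>
            principal_submatrix A I \<in> GDE 2) \<or>
      (\<exists>k I. 3 \<le> k \<and> k \<le> n \<and> I \<subseteq> {..<n} \<and> card I = k \<and>
            irreducible_mat k (principal_submatrix A I) \<and>
            (\<exists>\<phi>. mat_inv (diag_part (principal_submatrix A I)) * principal_submatrix A I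
                   \<in> L_class k \<phi> \<inter> GDE k))"
    (is "?crit \<longleftrightarrow> ?two \<or> ?more")
  proof
    assume ?crit
    then obtain I where I: "I \<subseteq> {..<n}" "2 \<le> card I" "critical I" by blast
    show "?two \<or> ?more"
    proof (cases "card I = 2")
      case True
      then show ?thesis using critical_iff_2[OF I(1) True] I by blast
    next
      case False
      then have "3 \<le> card I" using I(2) by simp
      moreover have "card I \<le> n" using card_mono[OF _ I(1)] by simp
      moreover have "0 < card I" using I(2) by simp
      ultimately show ?thesis using critical_iff[OF I(1) refl] I(1,3) by blast
    qed
  next
    assume "?two \<or> ?more"
    then show ?crit
    proof
      assume ?two
      then obtain I where I: "I \<subseteq> {..<n}" "card I = 2" "irreducible_mat 2 (principal_submatrix A I)"
        "principal_submatrix A I \<in> GDE 2" by blast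
      then have "critical I" using critical_iff_2[OF I(1,2)] by simp
      with I show ?crit by (intro exI[of _ I]) simp
    next
      assume ?more
      then obtain k I where I: "3 \<le> k" "I \<subseteq> {..<n}" "card I = k" "irreducible_mat k (principal_submatrix A I)"
        "\<exists>\<phi>. mat_inv (diag_part (principal_submatrix A I)) * principal_submatrix A I \<in> L_class k \<phi> \<inter> GDE k"
        by blast
      have "critical I" using critical_iff[OF I(2,3)] I(1,4,5) by simp
      with I show ?crit by (intro exI[of _ I]) simp
    qed
  qed
  then show ?thesis
    using BGS_convergent_iff[OF assms(4)] spectral_radius_less_1_iff_no_critical[OF assms(2)] by blast
qed

end
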